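(* Let $n \geq 2$, let $\Gamma=(V,E)$ be a finite graph, and let $(G_i)_{i\in V}$ be groups with $G_i \in \mathcal{G}'_n$ for every $i\in V$. Then the graph product $\overline{G}^\Gamma$ of $\overline{G}=(G_i)_{i\in V}$ along $\Gamma$ belongs to $\mathcal{G}'_{n+1}$.
   Context: For a finite alphabet $\Sigma$, $\mathrm{Aut}(\Sigma^{\mathbb{N}})$ is the group of homeomorphisms of $\Sigma^{\mathbb{N}}$ ($0\in\mathbb{N}$, product topology) commuting with the one-sided shift $\sigma(x)_i = x_{i+1}$. $\mathcal{G}'_n$ is the class of groups isomorphic to a subgroup of $\mathrm{Aut}(\Sigma^{\mathbb{N}})$ where $|\Sigma| = n$. Here $E\subset\{\{u,v\}: u,v\in V, u\ne v\}$, and the graph product is $\overline{G}^\Gamma = \langle \bigcup_{i\in V} G_i \mid [a,b]=e \text{ for all } \{i,j\}\in E,\ a\in G_i,\ b\in G_j\rangle$, where the groups $G_i$ are taken disjoint apart from sharing the identity and the relations of each $G_i$ are also imposed. *)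

theory Defs
  imports "HOL-Algebra.Bij" "HOL-Analysis.Function_Topology"
begin

section \<open>Automorphism groups of one-sided full shifts\<close>

definition full_shift :: "'a set \<Rightarrow> (nat \<Rightarrow> 'a) topology" where
  "full_shift \<Sigma> = product_topology (\<lambda>_. discrete_topology \<Sigma>) UNIV"

definition shift_map :: "(nat \<Rightarrow> 'a) \<Rightarrow> nat \<Rightarrow> 'a" where
  "shift_map x = (\<lambda>i. x (Suc i))"

text \<open>As usual for \<^const>\<open>BijGroup\<close>, a self-map of the space of configurations is represented by
  its extensional extension, so that equal maps are equal as HOL functions.\<close>

definition shift_aut :: "'a set \<Rightarrow> ((nat \<Rightarrow> 'a) \<Rightarrow> nat \<Rightarrow> 'a) set" where
  "shift_aut \<Sigma> = {f \<in> Bij (topspace (full_shift \<Sigma>)).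
     homeomorphic_map (full_shift \<Sigma>) (full_shift \<Sigma>) f \<and>
     (\<forall>x \<in> topspace (full_shift \<Sigma>). f (shift_map x) = shift_map (f x))}"

definition AutShift :: "'a set \<Rightarrow> ((nat \<Rightarrow> 'a) \<Rightarrow> nat \<Rightarrow> 'a) monoid" where
  "AutShift \<Sigma> = (BijGroup (topspace (full_shift \<Sigma>)))\<lparr>carrier := shift_aut \<Sigma>\<rparr>"

lemma topspace_full_shift: "topspace (full_shift \<Sigma>) = {x. \<forall>i. x i \<in> \<Sigma>}"
  by (auto simp: full_shift_def)

lemma shift_map_closed:
  "x \<in> topspace (full_shift \<Sigma>) \<Longrightarrow> shift_map x \<in> topspace (full_shift \<Sigma>)"
  by (simp add: topspace_full_shift shift_map_def)

lemma group_AutShift: "group (AutShift \<Sigma>)"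
proof -
  let ?T = "full_shift \<Sigma>" and ?X = "topspace (full_shift \<Sigma>)"
  interpret B: group "BijGroup ?X" by (rule group_BijGroup)
  have "subgroup (shift_aut \<Sigma>) (BijGroup ?X)"
  proof (rule B.subgroupI)
    show "shift_aut \<Sigma> \<subseteq> carrier (BijGroup ?X)"
      by (auto simp: shift_aut_def BijGroup_def)
    have "homeomorphic_map ?T ?T (\<lambda>x\<in>?X. x)"
      by (rule homeomorphic_map_eq[of _ _ id]) (auto simp: homeomorphic_map_id)
    then have "(\<lambda>x\<in>?X. x) \<in> shift_aut \<Sigma>"
      by (auto simp: shift_aut_def id_Bij shift_map_closed)
    then show "shift_aut \<Sigma> \<noteq> {}" by blast
  next
    fix f assume f: "f \<in> shift_aut \<Sigma>"
    then have fB: "f \<in> Bij ?X" and fh: "homeomorphic_map ?T ?T f"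
      and fs: "\<And>x. x \<in> ?X \<Longrightarrow> f (shift_map x) = shift_map (f x)"
      by (auto simp: shift_aut_def)
    have bij: "bij_betw f ?X ?X" using fB by (simp add: Bij_def)
    let ?g = "\<lambda>x\<in>?X. inv_into ?X f x"
    have gB: "?g \<in> Bij ?X" by (rule restrict_inv_into_Bij[OF fB])
    obtain h where h: "homeomorphic_maps ?T ?T f h"
      using fh by (auto simp: homeomorphic_map_maps)
    have hh: "homeomorphic_map ?T ?T h"
      using h homeomorphic_maps_map by blast
    have "h x = ?g x" if "x \<in> ?X" for x
    proof -
      have "f (h x) = x" "h x \<in> ?X"
        using h that homeomorphic_imp_surjective_map[OF hh] by (auto simp: homeomorphic_maps_def)
      then show ?thesis using that bij by (simp add: bij_betw_def inv_into_f_eq)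
    qed
    then have gh: "homeomorphic_map ?T ?T ?g"
      using hh homeomorphic_map_eq by blast
    have "?g (shift_map x) = shift_map (?g x)" if x: "x \<in> ?X" for x
    proof -
      let ?y = "inv_into ?X f x"
      have y: "?y \<in> ?X" "f ?y = x"
        using x bij by (simp_all add: bij_betw_def inv_into_into f_inv_into_f)
      have "f (shift_map ?y) = shift_map x" using fs y by simp
      then have "inv_into ?X f (shift_map x) = shift_map ?y"
        using bij y shift_map_closed by (metis bij_betw_def inv_into_f_f)
      then show ?thesis using x by (simp add: shift_map_closed)
    qed
    then show "inv\<^bsub>BijGroup ?X\<^esub> f \<in> shift_aut \<Sigma>"
      using gB gh by (simp only: inv_BijGroup[OF fB]) (simp add: shift_aut_def)
  next
    fix f g assume f: "f \<in> shift_aut \<Sigma>" and g: "g \<in> shift_aut \<Sigma>"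
    then have B: "f \<in> Bij ?X" "g \<in> Bij ?X" by (auto simp: shift_aut_def)
    have gX: "g x \<in> ?X" if "x \<in> ?X" for x
      using B(2) that by (auto simp: Bij_def bij_betw_def)
    have "homeomorphic_map ?T ?T (f \<circ> g)"
      using f g by (auto simp: shift_aut_def intro: homeomorphic_map_compose)
    then have "homeomorphic_map ?T ?T (compose ?X f g)"
      by (rule homeomorphic_map_eq) (simp add: compose_def)
    then show "f \<otimes>\<^bsub>BijGroup ?X\<^esub> g \<in> shift_aut \<Sigma>"
      using f g B gX by (auto simp: shift_aut_def BijGroup_def compose_Bij compose_def shift_map_closed)
         (simp_all add: compose_Bij[unfolded compose_def])
  qed
  then show ?thesis
    unfolding AutShift_def by (rule B.subgroup_imp_group)
qed

definition shift_class :: "nat \<Rightarrow> ('g, 'm) monoid_scheme \<Rightarrow> bool" where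
  "shift_class n H \<longleftrightarrow> group H \<and>
     (\<exists>(\<Sigma> :: nat set) K. finite \<Sigma> \<and> card \<Sigma> = n \<and> subgroup K (AutShift \<Sigma>) \<and>
        H \<cong> (AutShift \<Sigma>)\<lparr>carrier := K\<rparr>)"

section \<open>Group presentations\<close>

text \<open>The letter \<open>(x, True)\<close> stands for the generator \<open>x\<close>, the letter \<open>(x, False)\<close> for its
  formal inverse.\<close>

type_synonym 'a gword = "('a \<times> bool) list"

definition gwords :: "'a set \<Rightarrow> 'a gword set" where
  "gwords S = lists (S \<times> UNIV)"

inductive_set pres_rel :: "'a set \<Rightarrow> 'a gword set \<Rightarrow> ('a gword \<times> 'a gword) set"
  for S :: "'a set" and R :: "'a gword set" where
  refl: "w \<in> gwords S \<Longrightarrow> (w, w) \<in> pres_rel S R"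
| sym: "(v, w) \<in> pres_rel S R \<Longrightarrow> (w, v) \<in> pres_rel S R"
| trans: "(u, v) \<in> pres_rel S R \<Longrightarrow> (v, w) \<in> pres_rel S R \<Longrightarrow> (u, w) \<in> pres_rel S R"
| cancel: "u \<in> gwords S \<Longrightarrow> v \<in> gwords S \<Longrightarrow> x \<in> S \<Longrightarrow>
    (u @ [(x, b), (x, \<not> b)] @ v, u @ v) \<in> pres_rel S R"
| relator: "u \<in> gwords S \<Longrightarrow> v \<in> gwords S \<Longrightarrow> r \<in> R \<Longrightarrow> r \<in> gwords S \<Longrightarrow>
    (u @ r @ v, u @ v) \<in> pres_rel S R"

definition presented_group :: "'a set \<Rightarrow> 'a gword set \<Rightarrow> 'a gword set monoid" where
  "presented_group S R =
    \<lparr>carrier = gwords S // pres_rel S R,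
     mult = (\<lambda>A B. \<Union>u\<in>A. \<Union>v\<in>B. pres_rel S R `` {u @ v}),
     one = pres_rel S R `` {[]}\<rparr>"

lemma gwords_append [simp]: "u @ v \<in> gwords S \<longleftrightarrow> u \<in> gwords S \<and> v \<in> gwords S"
  by (auto simp: gwords_def)

lemma gwords_Nil [simp]: "[] \<in> gwords S"
  by (simp add: gwords_def)

lemma pres_rel_gwords: "(v, w) \<in> pres_rel S R \<Longrightarrow> v \<in> gwords S \<and> w \<in> gwords S"
  by (induction rule: pres_rel.induct) (auto simp: gwords_def)

lemma equiv_pres_rel: "equiv (gwords S) (pres_rel S R)"
  by (rule equivI)
     (auto simp: refl_on_def sym_def trans_def dest: pres_rel_gwords
           intro: pres_rel.refl pres_rel.sym pres_rel.trans)

lemma pres_rel_context: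
  assumes "(v, w) \<in> pres_rel S R" "p \<in> gwords S" "q \<in> gwords S"
  shows "(p @ v @ q, p @ w @ q) \<in> pres_rel S R"
  using assms
proof (induction rule: pres_rel.induct)
  case (cancel u v x b)
  then show ?case using pres_rel.cancel[of "p @ u" S "v @ q" x b R] by simp
next
  case (relator u v r)
  then show ?case using pres_rel.relator[of "p @ u" S "v @ q" r R] by simp
qed (auto intro: pres_rel.refl pres_rel.sym pres_rel.trans)

lemma pres_rel_append:
  assumes "(u, u') \<in> pres_rel S R" "(v, v') \<in> pres_rel S R"
  shows "(u @ v, u' @ v') \<in> pres_rel S R"
  using pres_rel_context[OF assms(1), of "[]" v] pres_rel_context[OF assms(2), of u' "[]"]
    pres_rel_gwords[OF assms(1)] pres_rel_gwords[OF assms(2)]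
  by (auto intro: pres_rel.trans)

lemma presented_group_mult:
  assumes "u \<in> gwords S" "v \<in> gwords S"
  shows "pres_rel S R `` {u} \<otimes>\<^bsub>presented_group S R\<^esub> pres_rel S R `` {v} = pres_rel S R `` {u @ v}"
proof -
  have "congruent2 (pres_rel S R) (pres_rel S R) (\<lambda>u v. pres_rel S R `` {u @ v})"
    by (auto simp: congruent2_def intro!: equiv_class_eq[OF equiv_pres_rel] pres_rel_append)
  then show ?thesis
    using UN_equiv_class2[OF equiv_pres_rel equiv_pres_rel _ assms]
    by (simp add: presented_group_def)
qed

lemma pres_rel_inverse:
  "w \<in> gwords S \<Longrightarrow> (rev (map (\<lambda>(x, b). (x, \<not> b)) w) @ w, []) \<in> pres_rel S R"
proof (induction w)
  case Nil
  then show ?case by (simp add: pres_rel.refl)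
next
  case (Cons a w)
  obtain x b where a: "a = (x, b)" by (cases a)
  let ?i = "rev (map (\<lambda>(x, b). (x, \<not> b)) w)"
  have w: "w \<in> gwords S" "x \<in> S" "?i \<in> gwords S"
    using Cons.prems by (auto simp: a gwords_def)
  have "(?i @ [(x, \<not> b), (x, \<not> \<not> b)] @ w, ?i @ w) \<in> pres_rel S R"
    using w by (intro pres_rel.cancel)
  then show ?case using Cons.IH[OF w(1)] by (auto simp: a intro: pres_rel.trans)
qed

lemma group_presented_group: "group (presented_group S R)"
proof (rule groupI)
  let ?P = "presented_group S R"
  have car: "\<exists>w \<in> gwords S. A = pres_rel S R `` {w}" if "A \<in> carrier ?P" for A
    using that by (auto simp: presented_group_def elim: quotientE)
  have car': "pres_rel S R `` {w} \<in> carrier ?P" if "w \<in> gwords S" for w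
    using that by (simp add: presented_group_def quotientI)
  have one: "\<one>\<^bsub>?P\<^esub> = pres_rel S R `` {[]}" by (simp add: presented_group_def)
  show "\<one>\<^bsub>?P\<^esub> \<in> carrier ?P" by (simp add: one car')
  fix A assume A: "A \<in> carrier ?P"
  then obtain u where u: "u \<in> gwords S" "A = pres_rel S R `` {u}" using car by blast
  show "\<one>\<^bsub>?P\<^esub> \<otimes>\<^bsub>?P\<^esub> A = A" using u by (simp add: one presented_group_mult)
  show "\<exists>B\<in>carrier ?P. B \<otimes>\<^bsub>?P\<^esub> A = \<one>\<^bsub>?P\<^esub>"
  proof
    let ?i = "rev (map (\<lambda>(x, b). (x, \<not> b)) u)"
    have i: "?i \<in> gwords S" using u by (auto simp: gwords_def)
    then show "pres_rel S R `` {?i} \<in> carrier ?P" by (rule car')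
    show "pres_rel S R `` {?i} \<otimes>\<^bsub>?P\<^esub> A = \<one>\<^bsub>?P\<^esub>"
      using equiv_class_eq[OF equiv_pres_rel pres_rel_inverse[OF u(1)]]
      by (simp only: u(2) one presented_group_mult[OF i u(1)])
  qed
  fix B assume "B \<in> carrier ?P"
  then obtain v where v: "v \<in> gwords S" "B = pres_rel S R `` {v}" using car by blast
  show "A \<otimes>\<^bsub>?P\<^esub> B \<in> carrier ?P" using u v by (simp add: presented_group_mult car')
  fix C assume "C \<in> carrier ?P"
  then obtain w where w: "w \<in> gwords S" "C = pres_rel S R `` {w}" using car by blast
  show "A \<otimes>\<^bsub>?P\<^esub> B \<otimes>\<^bsub>?P\<^esub> C = A \<otimes>\<^bsub>?P\<^esub> (B \<otimes>\<^bsub>?P\<^esub> C)"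
    using u v w by (simp add: presented_group_mult)
qed

section \<open>Graph products\<close>

text \<open>A generator is a pair \<open>(i, a)\<close> with \<open>a\<close> in the \<open>i\<close>-th vertex group, which makes the vertex
  groups disjoint; the first set of relators identifies all their identity elements with the
  identity, the second one imposes the multiplication tables of the vertex groups.\<close>

definition graph_product_relators ::
  "'v set \<Rightarrow> 'v set set \<Rightarrow> ('v \<Rightarrow> ('g, 'm) monoid_scheme) \<Rightarrow> ('v \<times> 'g) gword set" where
  "graph_product_relators V E G =
     {[((i, \<one>\<^bsub>G i\<^esub>), True)] | i. i \<in> V} \<union>
     {[((i, a), True), ((i, b), True), ((i, a \<otimes>\<^bsub>G i\<^esub> b), False)] | i a b.
        i \<in> V \<and> a \<in> carrier (G i) \<and> b \<in> carrier (G i)} \<union>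
     {[((i, a), True), ((j, b), True), ((i, a), False), ((j, b), False)] | i j a b.
        i \<in> V \<and> j \<in> V \<and> {i, j} \<in> E \<and> a \<in> carrier (G i) \<and> b \<in> carrier (G j)}"

definition graph_product ::
  "'v set \<Rightarrow> 'v set set \<Rightarrow> ('v \<Rightarrow> ('g, 'm) monoid_scheme) \<Rightarrow> ('v \<times> 'g) gword set monoid" where
  "graph_product V E G =
     presented_group (SIGMA i:V. carrier (G i)) (graph_product_relators V E G)"

end

theory Submission
  imports Defs "HOL-Algebra.Coset"
begin

text \<open>
  The new symbol serves as a separator. In a configuration over the enlarged alphabet, the number of
  separators after a letter determines the vertex \<open>i\<close> that owns it, and \<open>G\<^sub>i\<close> acts on each maximal run
  of letters owned by \<open>i\<close>, read as a configuration over the old alphabet in which the last letter is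
  repeated forever. The final letter of a run may have a control: it belongs to the run only
  if the next letter, owned by a vertex that is distinct from \<open>i\<close> and not adjacent to \<open>i\<close>, has a prescribed value.
  Distant letters of a run do not see the control, so the maps remain local, and adjacent
  vertex groups commute.

  For faithfulness, take a reduced word and choose a chain of letters of the word, each the first one
  after its predecessor that does not commute with it. Arrange runs owned by the vertices of the chain,
  each controlled by the previous one, in two configurations that differ only in the static letter
  that controls the first run. Because every nontrivial element of \<open>G\<^sub>i\<close> distinguishes some word from this
  word shortened by its last letter, the difference propagates along the chain, each
  run being affected exactly when its letter acts. No later letter can undo the difference in the last
  run, hence the word does not act as the identity.
\<close>

section \<open>Actions on configurations by local maps\<close>

definition configs :: "nat \<Rightarrow> (nat \<Rightarrow> nat) set" where
  "configs n = {x. \<forall>i. x i < n}"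

lemma topspace_full_shift_lessThan: "topspace (full_shift {..<n}) = configs n"
  by (simp add: topspace_full_shift configs_def)

text \<open>Compactness: as the alphabet is discrete, the first letter of \<open>f x\<close> is
  constant on some cylinder around each point. Finitely many of these cylinders cover the space, and
  a bound on their lengths serves as \<open>r\<close>.\<close>

lemma continuous_map_imp_local:
  assumes fin: "finite \<Sigma>"
    and cont: "continuous_map (full_shift \<Sigma>) (full_shift \<Sigma>) f"
  shows "\<exists>r. \<forall>x\<in>topspace (full_shift \<Sigma>). \<forall>y\<in>topspace (full_shift \<Sigma>).
    (\<forall>k<r. x k = y k) \<longrightarrow> f x 0 = f y 0"
proof -
  let ?X = "topspace (full_shift \<Sigma>)"
  have loc: "\<exists>r::nat. \<forall>y\<in>?X. (\<forall>k<r. y k = x k) \<longrightarrow> f y 0 = f x 0" if x: "x \<in> ?X" for x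
  proof -
    let ?S = "{y \<in> ?X. f y 0 \<in> {f x 0}}"
    have c0: "continuous_map (full_shift \<Sigma>) (discrete_topology \<Sigma>) (\<lambda>y. f y 0)"
      using cont unfolding full_shift_def by (simp add: continuous_map_componentwise_UNIV)
    have "f x 0 \<in> \<Sigma>"
      using continuous_map_funspace[OF c0] x by auto
    then have "openin (full_shift \<Sigma>) ?S"
      by (intro openin_continuous_map_preimage[OF c0]) auto
    then obtain U where U: "finite {i. U i \<noteq> \<Sigma>}" "x \<in> Pi\<^sub>E UNIV U" "Pi\<^sub>E UNIV U \<subseteq> ?S"
      using x unfolding full_shift_def openin_product_topology_alt
      by (smt (verit, best) Collect_cong UNIV_I mem_Collect_eq singletonI topspace_discrete_topology)
    obtain r where r: "\<And>i. U i \<noteq> \<Sigma> \<Longrightarrow> i < r"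
      using U(1) finite_nat_set_iff_bounded by auto
    have "f y 0 = f x 0" if "y \<in> ?X" "\<forall>k<r. y k = x k" for y
    proof -
      have "y i \<in> U i" for i
        using U(2) r[of i] that by (cases "i < r") (auto simp: topspace_full_shift PiE_iff)
      then show ?thesis using U(3) by (auto simp: PiE_iff)
    qed
    then show ?thesis by blast
  qed
  then obtain \<rho> where \<rho>: "\<And>x y. \<lbrakk>x \<in> ?X; y \<in> ?X; \<forall>k<\<rho> x. y k = x k\<rbrakk> \<Longrightarrow> f y 0 = f x 0"
    by metis
  define C where "C x = {y \<in> ?X. \<forall>k<(\<rho> x :: nat). y k = x k}" for x
  have op: "openin (full_shift \<Sigma>) (C x)" if "x \<in> ?X" for x
  proof -
    have "C x = Pi\<^sub>E UNIV (\<lambda>k. if k < \<rho> x then {x k} else \<Sigma>)"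
      using that by (auto simp: C_def PiE_iff topspace_full_shift split: if_splits)
    moreover have "finite {k. (if k < \<rho> x then {x k} else \<Sigma>) \<noteq> \<Sigma>}"
      by (rule finite_subset[of _ "{..<\<rho> x}"]) auto
    ultimately show ?thesis
      using that by (auto simp: full_shift_def topspace_full_shift intro!: product_topology_basis)
  qed
  have "compact_space (full_shift \<Sigma>)"
    using fin by (simp add: full_shift_def compact_space_product_topology compact_space_discrete_topology)
  moreover have "?X \<subseteq> \<Union> (C ` ?X)" by (auto simp: C_def)
  ultimately obtain \<F> where \<F>: "finite \<F>" "\<F> \<subseteq> C ` ?X" "?X \<subseteq> \<Union> \<F>"
    using op unfolding compact_space_alt by (metis (no_types, lifting) imageE)
  then obtain A where A: "A \<subseteq> ?X" "finite A" "\<F> = C ` A"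
    by (meson finite_subset_image)
  obtain r where r: "\<And>x. x \<in> A \<Longrightarrow> \<rho> x \<le> r"
    using A(2) finite_nat_set_iff_bounded_le[of "\<rho> ` A"] by auto
  show ?thesis
  proof (intro exI[of _ r] ballI impI)
    fix x y assume xy: "x \<in> ?X" "y \<in> ?X" "\<forall>k<r. x k = y k"
    then obtain z where z: "z \<in> A" "x \<in> C z" using \<F>(3) A(3) by blast
    then have "y \<in> C z" using r[of z] xy by (auto simp: C_def)
    then show "f x 0 = f y 0" using z A(1) \<rho>[of z x] \<rho>[of z y] by (auto simp: C_def)
  qed
qed

lemma shift_map_commutes_shift:
  assumes "\<And>x. x \<in> configs n \<Longrightarrow> f (shift_map x) = shift_map (f x)" "x \<in> configs n"
  shows "f (\<lambda>i. x (i + k)) = (\<lambda>i. f x (i + k))"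
proof (induction k)
  case (Suc k)
  have "f (\<lambda>i. x (i + Suc k)) = shift_map (f (\<lambda>i. x (i + k)))"
    using assms(2) by (subst assms(1)[symmetric]) (auto simp: shift_map_def configs_def)
  then show ?case by (simp add: Suc shift_map_def)
qed simp

text \<open>Commuting with the shift makes coordinate \<open>j\<close> of \<open>f x\<close> depend
  on the first \<open>r + j\<close> coordinates of \<open>x\<close> alone, so preimages under each
  coordinate are unions of cylinders.\<close>

lemma local_imp_continuous_map:
  assumes closed: "\<And>x. x \<in> configs n \<Longrightarrow> f x \<in> configs n"
    and shift: "\<And>x. x \<in> configs n \<Longrightarrow> f (shift_map x) = shift_map (f x)"
    and loc: "\<And>x y. \<lbrakk>x \<in> configs n; y \<in> configs n; \<forall>k<r. x k = y k\<rbrakk> \<Longrightarrow> f x 0 = f y 0"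
  shows "continuous_map (full_shift {..<n}) (full_shift {..<n}) f"
proof -
  let ?T = "full_shift {..<n}"
  have nth: "f x j = f (\<lambda>i. x (i + j)) 0" if "x \<in> configs n" for x j
    using shift_map_commutes_shift[where f = f, OF shift that, of j] by simp
  have "continuous_map ?T (discrete_topology {..<n}) (\<lambda>x. f x j)" for j
    unfolding continuous_map_def
  proof (intro conjI allI impI)
    show "(\<lambda>x. f x j) \<in> topspace ?T \<rightarrow> topspace (discrete_topology {..<n})"
      using closed by (auto simp: topspace_full_shift configs_def)
    fix U
    have "openin ?T {x \<in> configs n. f x j \<in> U}"
      unfolding full_shift_def openin_product_topology_alt
    proof
      fix x assume x: "x \<in> {x \<in> configs n. f x j \<in> U}"
      let ?U = "\<lambda>k. if k < r + j then {x k} else {..<n}"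
      have "finite {k. ?U k \<noteq> {..<n}}"
        by (rule finite_subset[of _ "{..<r + j}"]) auto
      moreover have "y \<in> {x \<in> configs n. f x j \<in> U}" if y: "y \<in> Pi\<^sub>E UNIV ?U" for y
      proof -
        have yk: "y k \<in> ?U k" for k using y by (auto simp: PiE_iff)
        have "y k < n" for k using yk[of k] x by (auto simp: configs_def split: if_splits)
        moreover have "y k = x k" if "k < r + j" for k using yk[of k] that by simp
        ultimately have "f (\<lambda>i. y (i + j)) 0 = f (\<lambda>i. x (i + j)) 0" "y \<in> configs n"
          using x by (auto simp: configs_def intro!: loc)
        then show ?thesis using x nth[of x j] nth[of y j] by auto
      qed
      moreover have "x \<in> Pi\<^sub>E UNIV ?U" "\<forall>k. openin (discrete_topology {..<n}) (?U k)"
        using x by (auto simp: PiE_iff configs_def)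
      ultimately show "\<exists>U'. finite {i \<in> UNIV. U' i \<noteq> topspace (discrete_topology {..<n})} \<and>
          (\<forall>i\<in>UNIV. openin (discrete_topology {..<n}) (U' i)) \<and> x \<in> Pi\<^sub>E UNIV U' \<and>
          Pi\<^sub>E UNIV U' \<subseteq> {x \<in> configs n. f x j \<in> U}"
        by (intro exI[of _ ?U]) auto
    qed
    then show "openin ?T {x \<in> topspace ?T. f x j \<in> U}"
      by (simp add: topspace_full_shift_lessThan)
  qed
  then show ?thesis
    unfolding full_shift_def by (subst continuous_map_componentwise_UNIV) blast
qed

text \<open>A working form of \<open>shift_class n H\<close> over the alphabet of numbers below
  \<open>n\<close>. The maps are constrained on \<open>configs n\<close> only; a local rule at
  coordinate 0 stands in for continuity, and bijectivity comes from the action laws.\<close>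

locale faithful_shift_action = group H
  for n :: nat and H :: "('g, 'm) monoid_scheme" (structure) +
  fixes \<phi> :: "'g \<Rightarrow> (nat \<Rightarrow> nat) \<Rightarrow> nat \<Rightarrow> nat"
  assumes act_closed: "\<lbrakk>a \<in> carrier H; x \<in> configs n\<rbrakk> \<Longrightarrow> \<phi> a x \<in> configs n"
    and act_one: "x \<in> configs n \<Longrightarrow> \<phi> \<one> x = x"
    and act_mult: "\<lbrakk>a \<in> carrier H; b \<in> carrier H; x \<in> configs n\<rbrakk> \<Longrightarrow> \<phi> (a \<otimes> b) x = \<phi> a (\<phi> b x)"
    and act_shift: "\<lbrakk>a \<in> carrier H; x \<in> configs n\<rbrakk> \<Longrightarrow> \<phi> a (shift_map x) = shift_map (\<phi> a x)"
    and act_local: "a \<in> carrier H \<Longrightarrow>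
      \<exists>r. \<forall>x\<in>configs n. \<forall>y\<in>configs n. (\<forall>k<r. x k = y k) \<longrightarrow> \<phi> a x 0 = \<phi> a y 0"
    and act_faithful: "\<lbrakk>a \<in> carrier H; a \<noteq> \<one>\<rbrakk> \<Longrightarrow> \<exists>x\<in>configs n. \<phi> a x \<noteq> x"
begin

lemma act_nth: "\<lbrakk>a \<in> carrier H; x \<in> configs n\<rbrakk> \<Longrightarrow> \<phi> a x j = \<phi> a (\<lambda>i. x (i + j)) 0"
  using shift_map_commutes_shift[of n "\<phi> a" x j] act_shift by simp

lemma act_continuous:
  assumes "a \<in> carrier H"
  shows "continuous_map (full_shift {..<n}) (full_shift {..<n}) (\<phi> a)"
proof -
  obtain r where "\<forall>x\<in>configs n. \<forall>y\<in>configs n. (\<forall>k<r. x k = y k) \<longrightarrow> \<phi> a x 0 = \<phi> a y 0"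
    using act_local[OF assms] by blast
  then show ?thesis
    using act_closed[OF assms] act_shift[OF assms] by (intro local_imp_continuous_map[where r = r]) blast+
qed

lemma act_inv: "\<lbrakk>a \<in> carrier H; x \<in> configs n\<rbrakk> \<Longrightarrow> \<phi> (inv a) (\<phi> a x) = x"
  by (metis act_mult act_one inv_closed l_inv)

lemma act_inv': "\<lbrakk>a \<in> carrier H; x \<in> configs n\<rbrakk> \<Longrightarrow> \<phi> a (\<phi> (inv a) x) = x"
  by (metis act_inv inv_closed inv_inv)

lemma restrict_act_in_shift_aut:
  assumes a: "a \<in> carrier H"
  shows "restrict (\<phi> a) (configs n) \<in> shift_aut {..<n}"
proof -
  let ?T = "full_shift {..<n}"
  have "homeomorphic_maps ?T ?T (\<phi> a) (\<phi> (inv a))"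
    using a by (auto simp: homeomorphic_maps_def act_continuous topspace_full_shift_lessThan act_inv act_inv')
  then have "homeomorphic_map ?T ?T (\<phi> a)" by (rule homeomorphic_maps_map[THEN iffD1, THEN conjunct1])
  then have hom: "homeomorphic_map ?T ?T (restrict (\<phi> a) (configs n))"
    by (rule homeomorphic_map_eq) (simp add: topspace_full_shift_lessThan)
  then have "bij_betw (restrict (\<phi> a) (configs n)) (configs n) (configs n)"
    using homeomorphic_eq_everything_map[of ?T ?T]
    by (simp add: bij_betw_def topspace_full_shift_lessThan)
  then have "restrict (\<phi> a) (configs n) \<in> Bij (configs n)" by (simp add: Bij_def)
  moreover have "shift_map x \<in> configs n" if "x \<in> configs n" for x
    using that by (simp add: shift_map_def configs_def)
  ultimately show ?thesis
    using a hom by (simp add: shift_aut_def topspace_full_shift_lessThan act_shift)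
qed

lemma shift_class: "shift_class n H"
proof -
  let ?A = "AutShift {..<n}"
  define h where "h a = restrict (\<phi> a) (configs n)" for a
  have hc: "h a \<in> carrier ?A" if "a \<in> carrier H" for a
    using that by (simp add: AutShift_def h_def restrict_act_in_shift_aut)
  have hm: "h (a \<otimes> b) = h a \<otimes>\<^bsub>?A\<^esub> h b" if "a \<in> carrier H" "b \<in> carrier H" for a b
  proof -
    have "h a \<in> Bij (configs n)" "h b \<in> Bij (configs n)"
      using hc that by (auto simp: AutShift_def shift_aut_def topspace_full_shift_lessThan)
    then have "h a \<otimes>\<^bsub>?A\<^esub> h b = compose (configs n) (h a) (h b)"
      by (simp add: AutShift_def BijGroup_def topspace_full_shift_lessThan)
    also have "\<dots> = h (a \<otimes> b)"
      unfolding h_def compose_def using act_closed[OF that(2)] act_mult[OF that]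
      by (intro restrict_ext) simp
    finally show ?thesis by simp
  qed
  interpret hom: group_hom H ?A h
    using hc hm by (auto simp: group_hom_def group_hom_axioms_def hom_def group_AutShift is_group)
  have "inj_on h (carrier H)"
  proof (subst hom.inj_iff_trivial_ker, rule equalityI)
    show "kernel H ?A h \<subseteq> {\<one>}"
    proof
      fix a assume "a \<in> kernel H ?A h"
      then have a: "a \<in> carrier H" "h a = h \<one>" by (auto simp: kernel_def)
      have "\<phi> a x = x" if "x \<in> configs n" for x
        using that act_one[OF that] fun_cong[OF a(2), of x] unfolding h_def restrict_apply by simp
      then show "a \<in> {\<one>}" using act_faithful[OF a(1)] by blast
    qed
  qed (auto simp: kernel_def)
  then have "h \<in> iso H (?A\<lparr>carrier := h ` carrier H\<rparr>)"
    using hm by (auto simp: iso_def hom_def bij_betw_def)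
  moreover have "subgroup (h ` carrier H) ?A" by (rule hom.img_is_subgroup)
  ultimately show ?thesis
    unfolding shift_class_def is_iso_def using is_group
    by (intro conjI exI[of _ "{..<n}"] exI[of _ "h ` carrier H"]) auto
qed

end

text \<open>The isomorphism onto a subgroup of \<open>AutShift \<Sigma>\<close> is transported along
  a bijection \<open>\<beta>\<close> between the numbers below \<open>n\<close> and
  \<open>\<Sigma>\<close>.\<close>

lemma shift_class_imp_action:
  assumes "shift_class n H"
  shows "\<exists>\<phi>. faithful_shift_action n H \<phi>"
proof -
  obtain \<Sigma> :: "nat set" and K where \<Sigma>: "finite \<Sigma>" "card \<Sigma> = n" and K: "subgroup K (AutShift \<Sigma>)"
    and iso: "H \<cong> (AutShift \<Sigma>)\<lparr>carrier := K\<rparr>" and H: "group H"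
    using assms by (auto simp: shift_class_def)
  interpret H: group H by (rule H)
  interpret A: group "AutShift \<Sigma>" by (rule group_AutShift)
  obtain \<psi> where \<psi>: "\<psi> \<in> iso H ((AutShift \<Sigma>)\<lparr>carrier := K\<rparr>)"
    using iso by (auto simp: is_iso_def)
  obtain \<beta> where \<beta>: "bij_betw \<beta> {..<n} \<Sigma>"
    using \<Sigma> by (metis atLeast0LessThan ex_bij_betw_nat_finite)
  define \<beta>' where "\<beta>' = inv_into {..<n} \<beta>"
  let ?X = "topspace (full_shift \<Sigma>)"
  have b1: "\<beta>' (\<beta> k) = k" if "k < n" for k
    using \<beta> that by (simp add: \<beta>'_def bij_betw_def inv_into_f_f)
  have b2: "\<beta> (\<beta>' s) = s" if "s \<in> \<Sigma>" for s
    using \<beta> that by (simp add: \<beta>'_def bij_betw_def f_inv_into_f)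
  have b3: "\<beta>' s < n" if "s \<in> \<Sigma>" for s
    using \<beta> that inv_into_into[of s \<beta> "{..<n}"] by (simp add: \<beta>'_def bij_betw_def)
  have b4: "\<beta> k \<in> \<Sigma>" if "k < n" for k
    using \<beta> that by (auto simp: bij_betw_def)
  have bX: "\<beta> \<circ> x \<in> ?X" if "x \<in> configs n" for x
    using b4 that by (auto simp: topspace_full_shift configs_def)
  have \<psi>A: "\<psi> a \<in> shift_aut \<Sigma>" if "a \<in> carrier H" for a
    using \<psi> that subgroup.subset[OF K] by (auto simp: iso_def hom_def AutShift_def)
  have \<psi>B: "\<psi> a \<in> Bij ?X" if "a \<in> carrier H" for a
    using \<psi>A[OF that] by (simp add: shift_aut_def)
  have \<psi>X: "\<psi> a x \<in> ?X" if "a \<in> carrier H" "x \<in> ?X" for a x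
    using \<psi>B[OF that(1)] that(2) by (auto simp: Bij_def bij_betw_def)
  have one: "\<psi> \<one>\<^bsub>H\<^esub> = \<one>\<^bsub>AutShift \<Sigma>\<^esub>"
    using hom_one[of \<psi> H "(AutShift \<Sigma>)\<lparr>carrier := K\<rparr>"] \<psi> H A.subgroup_imp_group[OF K]
    by (simp add: iso_def)
  then have \<psi>1: "\<psi> \<one>\<^bsub>H\<^esub> x = x" if "x \<in> ?X" for x
    using that by (simp add: AutShift_def BijGroup_def)
  have \<psi>m: "\<psi> (a \<otimes>\<^bsub>H\<^esub> b) x = \<psi> a (\<psi> b x)" if "a \<in> carrier H" "b \<in> carrier H" "x \<in> ?X" for a b x
  proof -
    have "\<psi> (a \<otimes>\<^bsub>H\<^esub> b) = \<psi> a \<otimes>\<^bsub>AutShift \<Sigma>\<^esub> \<psi> b"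
      using \<psi> that by (auto simp: iso_def hom_def)
    then show ?thesis
      using that \<psi>B by (simp add: AutShift_def BijGroup_def compose_def)
  qed
  define \<phi> where "\<phi> a x = \<beta>' \<circ> \<psi> a (\<beta> \<circ> x)" for a x
  have \<beta>\<phi>: "\<beta> \<circ> \<phi> a x = \<psi> a (\<beta> \<circ> x)" if "a \<in> carrier H" "x \<in> configs n" for a x
    using \<psi>X[OF that(1) bX[OF that(2)]] b2 by (auto simp: \<phi>_def fun_eq_iff topspace_full_shift)
  have "faithful_shift_action n H \<phi>"
  proof (intro faithful_shift_action.intro faithful_shift_action_axioms.intro)
    show "group H" by (rule H)
  next
    fix a x assume ax: "a \<in> carrier H" "x \<in> configs n"
    show "\<phi> a x \<in> configs n"
      using \<psi>X[OF ax(1) bX[OF ax(2)]] b3 by (auto simp: \<phi>_def topspace_full_shift configs_def)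
    have "shift_map (\<beta> \<circ> x) = \<beta> \<circ> shift_map x" by (auto simp: shift_map_def)
    moreover have "\<psi> a (shift_map (\<beta> \<circ> x)) = shift_map (\<psi> a (\<beta> \<circ> x))"
      using \<psi>A[OF ax(1)] bX[OF ax(2)] by (simp add: shift_aut_def)
    ultimately have "\<psi> a (\<beta> \<circ> shift_map x) = shift_map (\<psi> a (\<beta> \<circ> x))"
      by simp
    then show "\<phi> a (shift_map x) = shift_map (\<phi> a x)"
      by (simp add: \<phi>_def shift_map_def comp_def)
    fix b assume b: "b \<in> carrier H"
    show "\<phi> (b \<otimes>\<^bsub>H\<^esub> a) x = \<phi> b (\<phi> a x)"
      using \<psi>m[OF b ax(1) bX[OF ax(2)]] \<beta>\<phi>[OF ax] by (simp add: \<phi>_def)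
  next
    fix x assume "x \<in> configs n"
    then show "\<phi> \<one>\<^bsub>H\<^esub> x = x" using \<psi>1[OF bX, of x] b1 by (auto simp: \<phi>_def configs_def)
  next
    fix a assume a: "a \<in> carrier H"
    have "continuous_map (full_shift \<Sigma>) (full_shift \<Sigma>) (\<psi> a)"
      using \<psi>A[OF a] by (auto simp: shift_aut_def intro: homeomorphic_imp_continuous_map)
    then obtain r where "\<forall>x\<in>?X. \<forall>y\<in>?X. (\<forall>k<r. x k = y k) \<longrightarrow> \<psi> a x 0 = \<psi> a y 0"
      using continuous_map_imp_local[OF \<Sigma>(1)] by blast
    then have "\<phi> a x 0 = \<phi> a y 0"
      if "x \<in> configs n" "y \<in> configs n" "\<forall>k<r. x k = y k" for x y
      using bX[OF that(1)] bX[OF that(2)] that(3) unfolding \<phi>_def by (metis comp_apply)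
    then show "\<exists>r. \<forall>x\<in>configs n. \<forall>y\<in>configs n. (\<forall>k<r. x k = y k) \<longrightarrow> \<phi> a x 0 = \<phi> a y 0"
      by blast
  next
    fix a assume a: "a \<in> carrier H" "a \<noteq> \<one>\<^bsub>H\<^esub>"
    show "\<exists>x\<in>configs n. \<phi> a x \<noteq> x"
    proof (rule ccontr)
      assume "\<not> (\<exists>x\<in>configs n. \<phi> a x \<noteq> x)"
      then have id: "\<phi> a x = x" if "x \<in> configs n" for x using that by blast
      have "\<psi> a y = \<psi> \<one>\<^bsub>H\<^esub> y" if y: "y \<in> ?X" for y
      proof -
        have c: "\<beta>' \<circ> y \<in> configs n" using y b3 by (auto simp: topspace_full_shift configs_def)
        have "\<beta> \<circ> (\<beta>' \<circ> y) = y" using y b2 by (auto simp: topspace_full_shift fun_eq_iff)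
        then show ?thesis using \<beta>\<phi>[OF a(1) c] id[OF c] \<psi>1[OF y] by simp
      qed
      \<comment> \<open>Members of \<open>Bij ?X\<close> are extensional, so agreement on
        \<open>?X\<close> is already equality of functions.\<close>
      then have "\<psi> a = \<psi> \<one>\<^bsub>H\<^esub>"
        using \<psi>B[OF a(1)] \<psi>B[OF H.one_closed] by (auto simp: Bij_def intro: extensionalityI)
      moreover have "inj_on \<psi> (carrier H)" using \<psi> by (auto simp: iso_def bij_betw_def)
      ultimately show False using a by (auto dest: inj_onD)
    qed
  qed
  then show ?thesis by blast
qed

section \<open>Reduced words in graph products\<close>

locale vertex_groups =
  fixes V :: "'v set" and E :: "'v set set" and G :: "'v \<Rightarrow> ('g, 'm) monoid_scheme"
  assumes group_vertex: "i \<in> V \<Longrightarrow> group (G i)"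
begin

definition letters :: "('v \<times> 'g) set" where
  "letters = (SIGMA i:V. carrier (G i))"

text \<open>The usual reduced words of a graph product: no two letters of one vertex can be shuffled
  together, because a letter between them belongs to a vertex that does not commute with
  theirs.\<close>

definition reduced :: "('v \<times> 'g) list \<Rightarrow> bool" where
  "reduced us \<longleftrightarrow> (\<forall>(i, a)\<in>set us. a \<noteq> \<one>\<^bsub>G i\<^esub>) \<and>
     (\<forall>us1 i a us2 b us3. us = us1 @ (i, a) # us2 @ (i, b) # us3 \<longrightarrow>
        (\<exists>j\<in>fst ` set us2. j \<noteq> i \<and> {i, j} \<notin> E))"

lemma reducedD:
  "reduced (us1 @ (i, a) # us2 @ (i, b) # us3) \<Longrightarrow> \<exists>j\<in>fst ` set us2. j \<noteq> i \<and> {i, j} \<notin> E"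
  unfolding reduced_def by metis

section \<open>Consequences of the defining relations\<close>

abbreviation rel :: "('v \<times> 'g) gword \<Rightarrow> ('v \<times> 'g) gword \<Rightarrow> bool" (infix "\<approx>\<^sub>w" 50) where
  "u \<approx>\<^sub>w v \<equiv> (u, v) \<in> pres_rel letters (graph_product_relators V E G)"

abbreviation pos :: "('v \<times> 'g) list \<Rightarrow> ('v \<times> 'g) gword" where
  "pos \<equiv> map (\<lambda>s. (s, True))"

lemma pos_gwords: "us \<in> lists letters \<Longrightarrow> pos us \<in> gwords letters"
  by (auto simp: gwords_def)

lemma rel_context: "\<lbrakk>v \<approx>\<^sub>w w; p \<in> gwords letters; q \<in> gwords letters\<rbrakk> \<Longrightarrow> p @ v @ q \<approx>\<^sub>w p @ w @ q"
  by (rule pres_rel_context)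

lemma rel_relator: "\<lbrakk>r \<in> graph_product_relators V E G; r \<in> gwords letters\<rbrakk> \<Longrightarrow> r \<approx>\<^sub>w []"
  using pres_rel.relator[of "[]" letters "[]" r] by simp

lemma rel_cancel: "s \<in> letters \<Longrightarrow> [(s, b), (s, \<not> b)] \<approx>\<^sub>w []"
  using pres_rel.cancel[of "[]" letters "[]" s b] by simp

lemma rel_one: "i \<in> V \<Longrightarrow> [((i, \<one>\<^bsub>G i\<^esub>), True)] \<approx>\<^sub>w []"
  using group_vertex[of i]
  by (intro rel_relator) (auto simp: graph_product_relators_def gwords_def letters_def group.is_monoid)

lemma rel_mult:
  assumes i: "i \<in> V" and ab: "a \<in> carrier (G i)" "b \<in> carrier (G i)"
  shows "[((i, a), True), ((i, b), True)] \<approx>\<^sub>w [((i, a \<otimes>\<^bsub>G i\<^esub> b), True)]"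
proof -
  let ?c = "(i, a \<otimes>\<^bsub>G i\<^esub> b)" and ?w = "[((i, a), True), ((i, b), True)]"
  have l: "(i, a) \<in> letters" "(i, b) \<in> letters" "?c \<in> letters"
    using assms group_vertex[OF i] by (auto simp: letters_def group.is_monoid monoid.m_closed)
  have "?w @ [(?c, False), (?c, \<not> False)] @ [] \<approx>\<^sub>w ?w @ [] @ []"
    using l by (intro rel_context rel_cancel) (auto simp: gwords_def)
  moreover have "?w @ [(?c, False)] \<approx>\<^sub>w []"
    using l assms by (intro rel_relator) (auto simp: graph_product_relators_def gwords_def)
  then have "[] @ (?w @ [(?c, False)]) @ [(?c, True)] \<approx>\<^sub>w [] @ [] @ [(?c, True)]"
    using l by (intro rel_context) (auto simp: gwords_def)
  ultimately show ?thesis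
    by (auto intro: pres_rel.trans[OF pres_rel.sym])
qed

text \<open>Inserting first \<open>a\<close>-inverse times \<open>a\<close> and then
  \<open>b\<close>-inverse times \<open>b\<close> exposes the commutator relator as a prefix,
  leaving \<open>b a\<close>.\<close>

lemma rel_commute:
  assumes "i \<in> V" "j \<in> V" "{i, j} \<in> E" "a \<in> carrier (G i)" "b \<in> carrier (G j)"
  shows "[((i, a), True), ((j, b), True)] \<approx>\<^sub>w [((j, b), True), ((i, a), True)]"
proof -
  let ?a = "(i, a)" and ?b = "(j, b)"
  have l: "?a \<in> letters" "?b \<in> letters"
    using assms by (auto simp: letters_def)
  have 1: "[(?a, True), (?b, True)] @ [(?a, False), (?a, \<not> False)] @ [] \<approx>\<^sub>w [(?a, True), (?b, True)] @ [] @ []"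
    using l by (intro rel_context rel_cancel) (auto simp: gwords_def)
  have 2: "[(?a, True), (?b, True), (?a, False)] @ [(?b, False), (?b, \<not> False)] @ [(?a, True)]
      \<approx>\<^sub>w [(?a, True), (?b, True), (?a, False)] @ [] @ [(?a, True)]"
    using l by (intro rel_context rel_cancel) (auto simp: gwords_def)
  have "[(?a, True), (?b, True), (?a, False), (?b, False)] \<approx>\<^sub>w []"
    using l assms by (intro rel_relator) (auto simp: graph_product_relators_def gwords_def)
  then have 3: "[] @ [(?a, True), (?b, True), (?a, False), (?b, False)] @ [(?b, True), (?a, True)]
      \<approx>\<^sub>w [] @ [] @ [(?b, True), (?a, True)]"
    using l by (intro rel_context) (auto simp: gwords_def)
  have "[(?a, True), (?b, True)] \<approx>\<^sub>w [(?a, True), (?b, True), (?a, False), (?a, True)]"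
    using pres_rel.sym[OF 1] by simp
  moreover have "[(?a, True), (?b, True), (?a, False), (?a, True)]
      \<approx>\<^sub>w [(?a, True), (?b, True), (?a, False), (?b, False), (?b, True), (?a, True)]"
    using pres_rel.sym[OF 2] by simp
  moreover have "[(?a, True), (?b, True), (?a, False), (?b, False), (?b, True), (?a, True)]
      \<approx>\<^sub>w [(?b, True), (?a, True)]"
    using 3 by simp
  ultimately show ?thesis by (blast intro: pres_rel.trans)
qed

lemma rel_inverse:
  assumes "i \<in> V" "a \<in> carrier (G i)"
  shows "[((i, a), False)] \<approx>\<^sub>w [((i, inv\<^bsub>G i\<^esub> a), True)]"
proof -
  interpret group "G i" by (rule group_vertex[OF assms(1)])
  let ?a = "(i, a)" and ?b = "(i, inv\<^bsub>G i\<^esub> a)" and ?e = "(i, \<one>\<^bsub>G i\<^esub>)"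
  have l: "?a \<in> letters" "?b \<in> letters" "?e \<in> letters" using assms by (auto simp: letters_def)
  have 1: "[(?a, False)] @ [(?e, True)] @ [] \<approx>\<^sub>w [(?a, False)] @ [] @ []"
    using l assms by (intro rel_context rel_one) (auto simp: gwords_def)
  have "[(?a, True), (?b, True)] \<approx>\<^sub>w [(?e, True)]"
    using rel_mult[of i a "inv\<^bsub>G i\<^esub> a"] assms by simp
  then have 2: "[(?a, False)] @ [(?a, True), (?b, True)] @ [] \<approx>\<^sub>w [(?a, False)] @ [(?e, True)] @ []"
    using l by (intro rel_context) (auto simp: gwords_def)
  have 3: "[] @ [(?a, False), (?a, \<not> False)] @ [(?b, True)] \<approx>\<^sub>w [] @ [] @ [(?b, True)]"
    using l by (intro rel_context rel_cancel) (auto simp: gwords_def)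
  show ?thesis
    using pres_rel.trans[OF pres_rel.sym[OF pres_rel.trans[OF 2 1]]] 3 by simp
qed

text \<open>Formal inverses are replaced by inverses in the vertex groups, so that only positive
  words need to be reduced.\<close>

lemma ex_positive: "w \<in> gwords letters \<Longrightarrow> \<exists>us\<in>lists letters. w \<approx>\<^sub>w pos us"
proof (induction w)
  case Nil
  then show ?case by (intro bexI[of _ "[]"]) (auto intro: pres_rel.refl)
next
  case (Cons u w)
  obtain i a b where u: "u = ((i, a), b)" "i \<in> V" "a \<in> carrier (G i)"
    using Cons.prems by (cases u) (auto simp: gwords_def letters_def)
  interpret group "G i" by (rule group_vertex[OF u(2)])
  have w: "w \<in> gwords letters" "[u] \<in> gwords letters" using Cons.prems by (auto simp: gwords_def)
  then obtain us where us: "us \<in> lists letters" "w \<approx>\<^sub>w pos us" using Cons.IH by blast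
  obtain s where s: "s \<in> letters" "[u] \<approx>\<^sub>w pos [s]"
  proof (cases b)
    case True
    then have "[u] \<approx>\<^sub>w pos [(i, a)]" using w(2) u by (auto intro: pres_rel.refl)
    then show thesis using that[of "(i, a)"] u by (simp add: letters_def)
  next
    case False
    then have "[u] \<approx>\<^sub>w pos [(i, inv\<^bsub>G i\<^esub> a)]" using rel_inverse u by simp
    then show thesis using that[of "(i, inv\<^bsub>G i\<^esub> a)"] u by (simp add: letters_def)
  qed
  have "[u] @ w \<approx>\<^sub>w pos [s] @ pos us" by (rule pres_rel_append[OF s(2) us(2)])
  then show ?case using s(1) us(1) by (intro bexI[of _ "s # us"]) auto
qed

section \<open>Shortening positive words\<close>

lemma rel_pos_context:
  assumes "pos v \<approx>\<^sub>w pos w" "p \<in> lists letters" "q \<in> lists letters"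
  shows "pos (p @ v @ q) \<approx>\<^sub>w pos (p @ w @ q)"
  using rel_context[OF assms(1) pos_gwords[OF assms(2)] pos_gwords[OF assms(3)]] by simp

lemma ex_shorter_adjacent:
  assumes "us1 @ (i, a) # (i, b) # us2 \<in> lists letters"
  shows "\<exists>vs\<in>lists letters. length vs < length (us1 @ (i, a) # (i, b) # us2) \<and>
    pos (us1 @ (i, a) # (i, b) # us2) \<approx>\<^sub>w pos vs"
proof -
  have l: "us1 \<in> lists letters" "us2 \<in> lists letters" "i \<in> V" "a \<in> carrier (G i)" "b \<in> carrier (G i)"
    using assms by (auto simp: letters_def)
  interpret group "G i" by (rule group_vertex[OF l(3)])
  have "pos (us1 @ [(i, a), (i, b)] @ us2) \<approx>\<^sub>w pos (us1 @ [(i, a \<otimes>\<^bsub>G i\<^esub> b)] @ us2)"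
    using rel_mult l by (intro rel_pos_context) auto
  then show ?thesis
    using l by (intro bexI[of _ "us1 @ [(i, a \<otimes>\<^bsub>G i\<^esub> b)] @ us2"]) (auto simp: letters_def)
qed

text \<open>The left letter of \<open>i\<close> is moved to the right past its neighbours until it
  meets a letter of \<open>i\<close>, with which it merges. The prefix is generalised because it
  absorbs the letters that were passed.\<close>

lemma ex_shorter:
  assumes "us1 @ (i, a) # us2 @ (i, b) # us3 \<in> lists letters" "\<forall>j\<in>fst ` set us2. j = i \<or> {i, j} \<in> E"
  shows "\<exists>vs\<in>lists letters. length vs < length (us1 @ (i, a) # us2 @ (i, b) # us3) \<and>
    pos (us1 @ (i, a) # us2 @ (i, b) # us3) \<approx>\<^sub>w pos vs"
  using assms
proof (induction us2 arbitrary: us1)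
  case Nil
  then show ?case using ex_shorter_adjacent[of us1 i a b us3] by simp
next
  case (Cons u us2)
  obtain j c where u: "u = (j, c)" by (cases u)
  show ?case
  proof (cases "j = i")
    case True
    then show ?thesis using ex_shorter_adjacent[of us1 i a c "us2 @ (i, b) # us3"] Cons.prems u by simp
  next
    case False
    let ?us = "us2 @ (i, b) # us3"
    have l: "us1 \<in> lists letters" "?us \<in> lists letters" "i \<in> V" "a \<in> carrier (G i)"
      "j \<in> V" "c \<in> carrier (G j)" "{i, j} \<in> E" "(us1 @ [u]) @ (i, a) # ?us \<in> lists letters"
      using Cons.prems u False by (auto simp: letters_def)
    have "pos (us1 @ [(i, a), (j, c)] @ ?us) \<approx>\<^sub>w pos (us1 @ [(j, c), (i, a)] @ ?us)"
      using rel_commute l by (intro rel_pos_context) auto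
    moreover obtain vs where "vs \<in> lists letters" "length vs < length ((us1 @ [u]) @ (i, a) # ?us)"
      "pos ((us1 @ [u]) @ (i, a) # ?us) \<approx>\<^sub>w pos vs"
      using Cons.IH[OF l(8)] Cons.prems(2) by auto
    ultimately show ?thesis
      using u by (intro bexI[of _ vs]) (auto intro: pres_rel.trans)
  qed
qed

text \<open>A shortest positive word for the same element is reduced: an identity letter could be
  deleted, and an unblocked pair of letters could be merged by \<open>ex_shorter\<close>.\<close>

lemma ex_reduced:
  assumes w: "w \<in> gwords letters"
  shows "\<exists>us\<in>lists letters. reduced us \<and> w \<approx>\<^sub>w pos us"
proof -
  obtain us where us: "us \<in> lists letters" "w \<approx>\<^sub>w pos us"
    and min: "\<And>vs. \<lbrakk>vs \<in> lists letters; w \<approx>\<^sub>w pos vs\<rbrakk> \<Longrightarrow> length us \<le> length vs"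
    using ex_positive[OF w] ex_has_least_nat[of "\<lambda>us. us \<in> lists letters \<and> w \<approx>\<^sub>w pos us" _ length] by metis
  have min': "length us \<le> length vs" if "vs \<in> lists letters" "pos us \<approx>\<^sub>w pos vs" for vs
    using min[OF that(1)] us(2) that(2) pres_rel.trans by metis
  have "a \<noteq> \<one>\<^bsub>G i\<^esub>" if "(i, a) \<in> set us" for i a
  proof
    assume "a = \<one>\<^bsub>G i\<^esub>"
    then obtain us1 us2 where eq: "us = us1 @ [(i, \<one>\<^bsub>G i\<^esub>)] @ us2"
      using \<open>(i, a) \<in> set us\<close> by (auto dest: split_list)
    then have l: "us1 \<in> lists letters" "us2 \<in> lists letters" "i \<in> V"
      using us(1) by (auto simp: letters_def)
    then have "pos us \<approx>\<^sub>w pos (us1 @ [] @ us2)"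
      unfolding eq using rel_one by (intro rel_pos_context) auto
    then show False using min'[of "us1 @ us2"] l eq by simp
  qed
  moreover have "\<exists>j\<in>fst ` set us2. j \<noteq> i \<and> {i, j} \<notin> E"
    if "us = us1 @ (i, a) # us2 @ (i, b) # us3" for us1 i a us2 b us3
  proof (rule ccontr)
    assume "\<not> ?thesis"
    then have "\<forall>j\<in>fst ` set us2. j = i \<or> {i, j} \<in> E" by blast
    from ex_shorter[OF us(1)[unfolded that] this] show False
      using min' unfolding that by (meson not_le)
  qed
  ultimately have "reduced us" unfolding reduced_def by blast
  then show ?thesis using us by blast
qed

text \<open>Needed since the action of a group word applies its last letter first, whereas the
  analysis of reduced words applies letters in list order.\<close>

lemma reduced_rev: "reduced us \<Longrightarrow> reduced (rev us)"
proof -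
  assume us: "reduced us"
  have "\<exists>j\<in>fst ` set us2. j \<noteq> i \<and> {i, j} \<notin> E"
    if "rev us = us1 @ (i, a) # us2 @ (i, b) # us3" for us1 i a us2 b us3
  proof -
    have "us = rev us3 @ (i, b) # rev us2 @ (i, a) # rev us1"
      using arg_cong[OF that, of rev] by simp
    then show ?thesis using reducedD us by fastforce
  qed
  moreover have "\<forall>(i, a)\<in>set (rev us). a \<noteq> \<one>\<^bsub>G i\<^esub>" using us by (simp add: reduced_def)
  ultimately show ?thesis unfolding reduced_def by blast
qed

end

section \<open>Configurations with typed letters\<close>

datatype 'v letter_type = Inert | Inner 'v | Final 'v nat

fun owner :: "'v letter_type \<Rightarrow> 'v option" where
  "owner Inert = None"
| "owner (Inner i) = Some i"
| "owner (Final i c) = Some i"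

text \<open>The function \<open>dec\<close> decodes a number of separators into a letter type. The
  cut-off value \<open>N\<close> is reserved for \<open>Inert\<close>: a letter of any other type
  has fewer than \<open>N\<close> separators after it, so a proper letter follows them.\<close>

locale graph_shift = vertex_groups V E G
  for V :: "'v set" and E :: "'v set set" and G :: "'v \<Rightarrow> ('g, 'm) monoid_scheme" +
  fixes n :: nat
    and \<phi> :: "'v \<Rightarrow> 'g \<Rightarrow> (nat \<Rightarrow> nat) \<Rightarrow> nat \<Rightarrow> nat"
    and N :: nat and dec :: "nat \<Rightarrow> 'v letter_type"
  assumes n_ge_2: "n \<ge> 2"
    and edges: "E \<subseteq> {{u, v} | u v. u \<in> V \<and> v \<in> V \<and> u \<noteq> v}"
    and vertex_action: "i \<in> V \<Longrightarrow> faithful_shift_action n (G i) (\<phi> i)"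
    and dec_Inert: "dec N = Inert"
    and dec_Inner: "i \<in> V \<Longrightarrow> \<exists>d<N. dec d = Inner i"
    and dec_Final: "\<lbrakk>i \<in> V; c < n\<rbrakk> \<Longrightarrow> \<exists>d<N. dec d = Final i c"
begin

text \<open>The symbol \<open>n\<close> is the separator. The number of separators following a letter, cut off at \<open>N\<close>,
  encodes its type. An \<open>Inner\<close> letter is glued to the next letter, if that is active for the same vertex;
  a \<open>Final i c\<close> letter is active only if the next letter is \<open>c\<close>, and this next letter must not belong
  to \<open>i\<close> or to a neighbour of \<open>i\<close>, so that adjacent vertex groups do not affect each other.\<close>

definition gap :: "(nat \<Rightarrow> nat) \<Rightarrow> nat \<Rightarrow> nat" where
  "gap x p = (LEAST d. d = N \<or> x (p + Suc d) \<noteq> n)"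

definition kind :: "(nat \<Rightarrow> nat) \<Rightarrow> nat \<Rightarrow> 'v letter_type" where
  "kind x p = dec (gap x p)"

definition nxt :: "(nat \<Rightarrow> nat) \<Rightarrow> nat \<Rightarrow> nat" where
  "nxt x p = p + Suc (gap x p)"

text \<open>An \<open>Inert\<close> letter has no owner and so qualifies for every vertex; the chain
  in the faithfulness proof starts from such letters.\<close>

definition controls :: "'v \<Rightarrow> 'v letter_type \<Rightarrow> bool" where
  "controls i t \<longleftrightarrow> (\<forall>j. owner t = Some j \<longrightarrow> j \<noteq> i \<and> {i, j} \<notin> E)"

definition active :: "'v \<Rightarrow> (nat \<Rightarrow> nat) \<Rightarrow> nat \<Rightarrow> bool" where
  "active i x p \<longleftrightarrow> x p \<noteq> n \<and>
     (kind x p = Inner i \<or>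
      kind x p = Final i (x (nxt x p)) \<and> controls i (kind x (nxt x p)))"

definition step :: "'v \<Rightarrow> (nat \<Rightarrow> nat) \<Rightarrow> nat \<Rightarrow> nat" where
  "step i x p = (if kind x p = Inner i \<and> active i x (nxt x p) then nxt x p else p)"

text \<open>At the end of a run \<open>step\<close> is stationary, i.e. the last letter of the run is repeated forever.\<close>

definition track :: "'v \<Rightarrow> (nat \<Rightarrow> nat) \<Rightarrow> nat \<Rightarrow> nat \<Rightarrow> nat" where
  "track i x p = (\<lambda>k. x ((step i x ^^ k) p))"

definition vact :: "'v \<Rightarrow> 'g \<Rightarrow> (nat \<Rightarrow> nat) \<Rightarrow> nat \<Rightarrow> nat" where
  "vact i a x = (\<lambda>p. if active i x p then \<phi> i a (track i x p) 0 else x p)"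

text \<open>Separators never move under the action, so whatever is determined by them is invariant
  in time.\<close>

definition same_hash :: "(nat \<Rightarrow> nat) \<Rightarrow> (nat \<Rightarrow> nat) \<Rightarrow> bool" where
  "same_hash x y \<longleftrightarrow> (\<forall>p. x p = n \<longleftrightarrow> y p = n)"

section \<open>Layout of a configuration: what the separators determine\<close>

lemma no_loop: "{i} \<notin> E"
  using edges by (auto simp: doubleton_eq_iff)

lemma gap_eqI: "\<lbrakk>d \<le> N; \<And>e. e < d \<Longrightarrow> x (p + Suc e) = n; d = N \<or> x (p + Suc d) \<noteq> n\<rbrakk> \<Longrightarrow> gap x p = d"
  unfolding gap_def by (rule Least_equality) (use leI in auto)

lemma gap_le: "gap x p \<le> N"
  unfolding gap_def by (rule Least_le) simp

lemma gap_cases: "gap x p = N \<or> x (nxt x p) \<noteq> n"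
  unfolding gap_def nxt_def by (rule LeastI_ex[of "\<lambda>d. d = N \<or> x (p + Suc d) \<noteq> n"]) blast

lemma same_hash_refl [simp]: "same_hash x x"
  by (simp add: same_hash_def)

lemma same_hash_sym: "same_hash x y \<Longrightarrow> same_hash y x"
  by (simp add: same_hash_def)

lemma same_hash_trans: "same_hash x y \<Longrightarrow> same_hash y z \<Longrightarrow> same_hash x z"
  by (simp add: same_hash_def)

lemma same_hash_gap: "same_hash x y \<Longrightarrow> gap x = gap y"
  by (simp add: same_hash_def gap_def fun_eq_iff)

lemma same_hash_kind: "same_hash x y \<Longrightarrow> kind x = kind y"
  using same_hash_gap[of x y] by (simp add: kind_def fun_eq_iff)

lemma same_hash_nxt: "same_hash x y \<Longrightarrow> nxt x = nxt y"
  using same_hash_gap[of x y] by (simp add: nxt_def fun_eq_iff)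

lemma active_owner: "active i x p \<Longrightarrow> owner (kind x p) = Some i"
  by (auto simp: active_def)

text \<open>Apart from the separators, activity for \<open>i\<close> reads letter values only at
  positions that satisfy \<open>controls i\<close>.\<close>

lemma active_cong:
  assumes "same_hash x y" "\<And>p. controls i (kind x p) \<Longrightarrow> x p = y p"
  shows "active i x = active i y"
  using assms same_hash_kind[OF assms(1)] same_hash_nxt[OF assms(1)]
  unfolding active_def same_hash_def by (metis)

lemma step_cong:
  assumes "same_hash x y" "\<And>p. controls i (kind x p) \<Longrightarrow> x p = y p"
  shows "step i x = step i y"
  using active_cong[OF assms] same_hash_kind[OF assms(1)] same_hash_nxt[OF assms(1)]
  by (simp add: step_def fun_eq_iff)

lemma active_step: "active i x p \<Longrightarrow> active i x (step i x p)"
  by (simp add: step_def)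

lemma active_funpow_step: "active i x p \<Longrightarrow> active i x ((step i x ^^ k) p)"
  by (induction k) (auto simp: active_step)

lemma track_in_configs:
  assumes "x \<in> configs (Suc n)" "active i x p"
  shows "track i x p \<in> configs n"
proof -
  have "x q < n" if "active i x q" for q
    using that assms(1) by (auto simp: active_def configs_def dest: spec[of _ q])
  then show ?thesis using active_funpow_step[OF assms(2)] by (simp add: configs_def track_def)
qed

lemma track_funpow: "track i x ((step i x ^^ k) p) = (\<lambda>l. track i x p (l + k))"
  by (simp add: track_def funpow_add)

lemma vact_less:
  assumes "i \<in> V" "a \<in> carrier (G i)" "x \<in> configs (Suc n)" "active i x p"
  shows "vact i a x p < n"
  using faithful_shift_action.act_closed[OF vertex_action[OF assms(1)] assms(2) track_in_configs[OF assms(3,4)]]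
    assms(4) by (simp add: vact_def configs_def)

lemma vact_other: "owner (kind x p) \<noteq> Some i \<Longrightarrow> vact i a x p = x p"
  using active_owner by (auto simp: vact_def)

lemma vact_inactive: "\<not> active i x p \<Longrightarrow> vact i a x p = x p"
  by (simp add: vact_def)

section \<open>The vertex groups act, and adjacent ones commute\<close>

context
  fixes i a
  assumes i: "i \<in> V" and a: "a \<in> carrier (G i)"
begin

interpretation A: faithful_shift_action n "G i" "\<phi> i"
  by (rule vertex_action[OF i])

lemma vact_closed: "x \<in> configs (Suc n) \<Longrightarrow> vact i a x \<in> configs (Suc n)"
  unfolding configs_def[of "Suc n"]
proof safe
  fix p assume x: "\<forall>p. x p < Suc n"
  then show "vact i a x p < Suc n"
    using vact_less[OF i a, of x p] by (cases "active i x p") (auto simp: configs_def vact_def)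
qed

lemma same_hash_vact: "x \<in> configs (Suc n) \<Longrightarrow> same_hash x (vact i a x)"
  unfolding same_hash_def using vact_less[OF i a, of x]
  by (metis active_def less_irrefl vact_def)

text \<open>A letter that controls \<open>j\<close> belongs neither to \<open>j\<close> nor to a
  neighbour of \<open>j\<close>, so \<open>vact i a\<close> leaves it alone. Hence the runs of
  \<open>j\<close> are the same before and after. This is the purpose of the restriction in
  \<open>controls\<close>.\<close>

lemma vact_struct:
  assumes "x \<in> configs (Suc n)" "j = i \<or> {j, i} \<in> E"
  shows "active j (vact i a x) = active j x" "step j (vact i a x) = step j x"
proof -
  have *: "same_hash x (vact i a x)" using assms(1) by (rule same_hash_vact)
  have **: "x p = vact i a x p" if "controls j (kind x p)" for p
  proof -
    have "owner (kind x p) \<noteq> Some i" using that assms(2) by (auto simp: controls_def)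
    then show ?thesis by (simp add: vact_other)
  qed
  show "active j (vact i a x) = active j x" "step j (vact i a x) = step j x"
    using active_cong[OF * **] step_cong[OF * **] by simp_all
qed

text \<open>The track from a later position of the run is a shift of the track from
  \<open>p\<close>, also where \<open>step\<close> has become stationary. Shift-equivariance of
  \<open>\<phi> i a\<close> therefore assembles the values at coordinate 0 into the image of the
  whole track.\<close>

lemma track_vact:
  assumes "x \<in> configs (Suc n)" "active i x p"
  shows "track i (vact i a x) p = \<phi> i a (track i x p)"
proof
  fix k
  have "track i (vact i a x) p k = vact i a x ((step i x ^^ k) p)"
    using assms by (simp add: track_def vact_struct)
  also have "\<dots> = \<phi> i a (\<lambda>l. track i x p (l + k)) 0"
    using active_funpow_step[OF assms(2)] by (simp add: vact_def track_funpow)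
  also have "\<dots> = \<phi> i a (track i x p) k"
    using A.act_nth[OF a track_in_configs[OF assms]] by simp
  finally show "track i (vact i a x) p k = \<phi> i a (track i x p) k" .
qed

end

lemma vact_mult:
  assumes "i \<in> V" "a \<in> carrier (G i)" "b \<in> carrier (G i)" "x \<in> configs (Suc n)"
  shows "vact i (a \<otimes>\<^bsub>G i\<^esub> b) x = vact i a (vact i b x)"
proof
  fix p
  interpret A: faithful_shift_action n "G i" "\<phi> i"
    by (rule vertex_action[OF assms(1)])
  have *: "active i (vact i b x) = active i x"
    using assms by (simp add: vact_struct)
  show "vact i (a \<otimes>\<^bsub>G i\<^esub> b) x p = vact i a (vact i b x) p"
  proof (cases "active i x p")
    case True
    then show ?thesis
      unfolding vact_def[of i a] using assms *
      by (simp add: track_vact vact_def[of i "_ \<otimes>\<^bsub>G i\<^esub> _"] A.act_mult[OF assms(2,3) track_in_configs])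
  qed (simp add: vact_inactive *)
qed

lemma vact_one:
  assumes "i \<in> V" "x \<in> configs (Suc n)"
  shows "vact i \<one>\<^bsub>G i\<^esub> x = x"
proof
  fix p
  interpret A: faithful_shift_action n "G i" "\<phi> i"
    by (rule vertex_action[OF assms(1)])
  show "vact i \<one>\<^bsub>G i\<^esub> x p = x p"
    using A.act_one[OF track_in_configs[OF assms(2)]] by (simp add: vact_def) (simp add: track_def)
qed

text \<open>The track at a position active for \<open>i\<close> consists of letters owned by
  \<open>i\<close>, which \<open>vact j b\<close> does not change; its layout is preserved as well
  by \<open>vact_struct\<close>.\<close>

lemma vact_commute_aux:
  assumes "i \<in> V" "j \<in> V" "{i, j} \<in> E" "a \<in> carrier (G i)" "b \<in> carrier (G j)"
    "x \<in> configs (Suc n)" "active i x p"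
  shows "vact i a (vact j b x) p = vact j b (vact i a x) p"
proof -
  have ij: "i \<noteq> j" using assms(3) no_loop by auto
  have "track i (vact j b x) p = track i x p"
  proof
    fix k
    have "owner (kind x ((step i x ^^ k) p)) = Some i"
      using active_owner active_funpow_step assms(7) by blast
    then show "track i (vact j b x) p k = track i x p k"
      using assms ij by (simp add: track_def vact_struct vact_other)
  qed
  then have "vact i a (vact j b x) p = vact i a x p"
    using assms(7) vact_struct(1)[OF assms(2,5,6)] assms(3) by (simp add: vact_def[of i])
  moreover have "owner (kind (vact i a x) p) \<noteq> Some j"
    using same_hash_kind[OF same_hash_vact[OF assms(1,4,6)]] active_owner[OF assms(7)] ij by simp
  ultimately show ?thesis by (simp add: vact_other)
qed

lemma vact_commute:
  assumes "i \<in> V" "j \<in> V" "{i, j} \<in> E" "a \<in> carrier (G i)" "b \<in> carrier (G j)" "x \<in> configs (Suc n)"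
  shows "vact i a (vact j b x) = vact j b (vact i a x)"
proof
  fix p
  have ji: "{j, i} \<in> E" using assms(3) by (simp add: insert_commute)
  consider "active i x p" | "active j x p" | "\<not> active i x p" "\<not> active j x p" by blast
  then show "vact i a (vact j b x) p = vact j b (vact i a x) p"
  proof cases
    case 3
    then have "\<not> active i (vact j b x) p" "\<not> active j (vact i a x) p"
      using assms ji by (simp_all add: vact_struct)
    then show ?thesis using 3 by (simp add: vact_inactive)
  qed (use vact_commute_aux[OF assms] vact_commute_aux[OF assms(2,1) ji assms(5,4,6)] in auto)
qed

section \<open>Shift-equivariance\<close>

lemma gap_shift: "gap (shift_map x) p = gap x (Suc p)"
  by (simp add: gap_def shift_map_def)

lemma kind_shift: "kind (shift_map x) p = kind x (Suc p)"
  by (simp add: kind_def gap_shift)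

lemma nxt_shift: "Suc (nxt (shift_map x) p) = nxt x (Suc p)"
  by (simp add: nxt_def gap_shift)

lemma active_shift: "active i (shift_map x) p = active i x (Suc p)"
proof -
  have "shift_map x p = x (Suc p)" for p by (simp add: shift_map_def)
  then show ?thesis unfolding active_def by (simp add: kind_shift nxt_shift)
qed

lemma step_shift: "Suc (step i (shift_map x) p) = step i x (Suc p)"
  unfolding step_def active_shift kind_shift nxt_shift[symmetric] by simp

lemma funpow_step_shift: "Suc ((step i (shift_map x) ^^ k) p) = (step i x ^^ k) (Suc p)"
  by (induction k) (simp_all add: step_shift)

lemma vact_shift: "vact i a (shift_map x) = shift_map (vact i a x)"
proof
  fix p
  have "track i (shift_map x) p = track i x (Suc p)"
    unfolding track_def using funpow_step_shift[where i = i and x = x and p = p, symmetric] by (auto simp: shift_map_def)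
  then show "vact i a (shift_map x) p = shift_map (vact i a x) p"
    by (simp add: vact_def active_shift) (simp add: shift_map_def)
qed

section \<open>Locality of the vertex actions\<close>

lemma gap_local:
  assumes "\<forall>q<R. x q = y q" "p + N + 1 < R"
  shows "gap x p = gap y p"
proof (rule gap_eqI)
  show "gap y p \<le> N" by (rule gap_le)
  have *: "x (p + Suc e) = y (p + Suc e)" if "e \<le> N" for e using that assms by auto
  show "gap y p = N \<or> x (p + Suc (gap y p)) \<noteq> n"
    using *[of "gap y p"] gap_le[of y p] gap_cases[of y p] by (simp add: nxt_def)
  fix e assume e: "e < gap y p"
  then have "y (p + Suc e) = n" unfolding gap_def using not_less_Least by blast
  then show "x (p + Suc e) = n" using *[of e] e gap_le[of y p] by simp
qed

text \<open>The next letter lies at most \<open>N + 1\<close> further on, and its type is settled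
  within another \<open>N + 1\<close> positions.\<close>

lemma active_local:
  assumes "\<forall>q<R. x q = y q" "p + 2 * N + 3 \<le> R"
  shows "active i x p = active i y p"
proof -
  have g: "gap x p = gap y p" using assms by (intro gap_local) auto
  then have 1: "kind x p = kind y p" "nxt x p = nxt y p" by (auto simp: kind_def nxt_def)
  have "nxt y p + N + 1 < R" using gap_le[of y p] assms(2) by (simp add: nxt_def)
  then have 2: "x (nxt y p) = y (nxt y p)" "kind x (nxt y p) = kind y (nxt y p)"
    using assms gap_local[OF assms(1)] by (auto simp: kind_def)
  have "x p = y p" using assms by auto
  then show ?thesis unfolding active_def 1 2 by simp
qed

text \<open>Compared with \<open>active_local\<close> there is one more jump of at most
  \<open>N + 1\<close>, because activity is tested at the next letter.\<close>

lemma step_local: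
  assumes "\<forall>q<R. x q = y q" "p + 3 * N + 4 \<le> R"
  shows "step i x p = step i y p"
proof -
  have g: "gap x p = gap y p" using assms by (intro gap_local) auto
  then have 1: "kind x p = kind y p" "nxt x p = nxt y p" by (auto simp: kind_def nxt_def)
  have "active i x (nxt y p) = active i y (nxt y p)"
    using gap_le[of y p] assms by (intro active_local) (auto simp: nxt_def)
  then show ?thesis by (simp add: step_def 1)
qed

lemma step_le: "step i x p \<le> p + N + 1"
  using gap_le[of x p] by (simp add: step_def nxt_def)

lemma funpow_step_local:
  assumes "\<forall>q<R. x q = y q" "(k + 1) * (3 * N + 4) \<le> R"
  shows "(step i x ^^ k) 0 = (step i y ^^ k) 0 \<and> (step i x ^^ k) 0 \<le> k * (N + 1)"
  using assms(2)
proof (induction k)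
  case (Suc k)
  then have IH: "(step i x ^^ k) 0 = (step i y ^^ k) 0" "(step i x ^^ k) 0 \<le> k * (N + 1)" by auto
  let ?p = "(step i y ^^ k) 0"
  have "?p + 3 * N + 4 \<le> R" using IH Suc.prems by (simp add: algebra_simps)
  then have "step i x ?p = step i y ?p" by (rule step_local[OF assms(1)])
  then show ?case using IH step_le[of i y ?p] by simp
qed simp

lemma vact_local:
  assumes "i \<in> V" "a \<in> carrier (G i)"
  shows "\<exists>R. \<forall>x\<in>configs (Suc n). \<forall>y\<in>configs (Suc n). (\<forall>q<R. x q = y q) \<longrightarrow> vact i a x 0 = vact i a y 0"
proof -
  obtain r where r: "\<forall>x\<in>configs n. \<forall>y\<in>configs n. (\<forall>k<r. x k = y k) \<longrightarrow> \<phi> i a x 0 = \<phi> i a y 0"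
    using faithful_shift_action.act_local[OF vertex_action[OF assms(1)] assms(2)] by blast
  \<comment> \<open>The first \<open>r\<close> track entries are determined by this window; the
    extra summand leaves room for the activity test at 0 even if \<open>r = 0\<close>.\<close>
  let ?R = "(r + 1) * (3 * N + 4)"
  have "vact i a x 0 = vact i a y 0"
    if xy: "x \<in> configs (Suc n)" "y \<in> configs (Suc n)" and eq: "\<forall>q<?R. x q = y q" for x y
  proof -
    have act: "active i x 0 = active i y 0" using eq by (intro active_local[where R = ?R]) auto
    have "track i x 0 k = track i y 0 k" if "k < r" for k
    proof -
      have le: "(k + 1) * (3 * N + 4) \<le> ?R" using that by (intro mult_right_mono) auto
      have "k * (N + 1) < (k + 1) * (3 * N + 4)" by (simp add: algebra_simps)
      then have "(step i y ^^ k) 0 < ?R" using funpow_step_local[OF eq le, of i] le by linarith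
      then show ?thesis using funpow_step_local[OF eq le, of i] eq by (simp add: track_def)
    qed
    then show ?thesis
      using r act track_in_configs[OF xy(1), of i 0] track_in_configs[OF xy(2), of i 0] eq
      by (auto simp: vact_def)
  qed
  then show ?thesis by blast
qed

end

section \<open>Reduced words act nontrivially\<close>

text \<open>Provides a finite run whose first letter, after \<open>a\<close> acts, reveals whether
  the last letter \<open>w L\<close> takes part in the run.\<close>

lemma (in faithful_shift_action) act_truncation:
  assumes a: "a \<in> carrier H" "a \<noteq> \<one>"
  obtains w L where "w \<in> configs n"
    "(if L = 0 then w 0 else \<phi> a (\<lambda>m. w (min m (L - 1))) 0) \<noteq> \<phi> a (\<lambda>m. w (min m L)) 0"
proof -
  obtain x j where x: "x \<in> configs n" "\<phi> a x j \<noteq> x j"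
    using act_faithful[OF a] by (metis ext)
  define w where "w = (\<lambda>i. x (i + j))"
  have w: "w \<in> configs n" "\<phi> a w 0 \<noteq> w 0"
    using x act_nth[OF a(1) x(1), of j] by (auto simp: w_def configs_def)
  \<comment> \<open>\<open>Q L\<close> is the new first letter for the run \<open>w 0\<close>, ...,
    \<open>w (L - 1)\<close>, with an empty run leaving \<open>w 0\<close> as it is. If
    \<open>Q\<close> were constant, its value would be \<open>w 0\<close>, but by locality long runs
    give the first letter of \<open>\<phi> a w\<close>.\<close>
  define Q where "Q L = (if L = 0 then w 0 else \<phi> a (\<lambda>m. w (min m (L - 1))) 0)" for L
  have "\<exists>L. Q L \<noteq> Q (Suc L)"
  proof (rule ccontr)
    assume "\<not> ?thesis"
    then have "Q L = Q 0" for L by (induction L) auto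
    then have "Q (Suc r) = w 0" for r by (metis Q_def)
    moreover obtain r where r: "\<forall>x\<in>configs n. \<forall>y\<in>configs n. (\<forall>k<r. x k = y k) \<longrightarrow> \<phi> a x 0 = \<phi> a y 0"
      using act_local[OF a(1)] by blast
    have "(\<lambda>m. w (min m r)) \<in> configs n" using w(1) by (auto simp: configs_def)
    then have "\<phi> a (\<lambda>m. w (min m r)) 0 = \<phi> a w 0"
      using r w(1) by (metis (no_types, lifting) less_imp_le min.absorb1)
    then have "Q (Suc r) = \<phi> a w 0" by (simp add: Q_def)
    ultimately show False using w(2) by metis
  qed
  then show thesis using that[OF w(1)] by (auto simp: Q_def)
qed

context graph_shift
begin

section \<open>Words acting in list order\<close>

abbreviation run :: "('v \<times> 'g) list \<Rightarrow> (nat \<Rightarrow> nat) \<Rightarrow> nat \<Rightarrow> nat" where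
  "run \<equiv> fold (\<lambda>(i, a). vact i a)"

lemma run_closed: "\<lbrakk>us \<in> lists letters; x \<in> configs (Suc n)\<rbrakk> \<Longrightarrow> run us x \<in> configs (Suc n)"
  by (induction us arbitrary: x) (auto simp: letters_def vact_closed)

lemma same_hash_run: "\<lbrakk>us \<in> lists letters; x \<in> configs (Suc n)\<rbrakk> \<Longrightarrow> same_hash x (run us x)"
proof (induction us arbitrary: x)
  case (Cons u us)
  obtain i a where u: "u = (i, a)" "i \<in> V" "a \<in> carrier (G i)"
    using Cons.prems by (auto simp: letters_def)
  have "same_hash x (vact i a x)" "vact i a x \<in> configs (Suc n)"
    using u Cons.prems same_hash_vact vact_closed by blast+
  then show ?case using Cons u by (auto intro: same_hash_trans)
qed simp

lemma run_shift: "run us (\<lambda>p. x (p + K)) = (\<lambda>p. run us x (p + K))"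
proof -
  have 1: "run us (shift_map x) = shift_map (run us x)" for x
    by (induction us arbitrary: x) (auto simp: vact_shift)
  show ?thesis
  proof (induction K)
    case (Suc K)
    have "run us (\<lambda>p. x (p + Suc K)) = run us (shift_map (\<lambda>p. x (p + K)))"
      by (simp add: shift_map_def)
    also have "\<dots> = shift_map (\<lambda>p. run us x (p + K))" by (simp only: 1 Suc)
    finally show ?case by (simp add: shift_map_def)
  qed simp
qed

lemma vact_inv:
  assumes "i \<in> V" "a \<in> carrier (G i)" "x \<in> configs (Suc n)"
  shows "vact i (inv\<^bsub>G i\<^esub> a) (vact i a x) = x" "vact i a (vact i (inv\<^bsub>G i\<^esub> a) x) = x"
proof -
  interpret A: faithful_shift_action n "G i" "\<phi> i"
    by (rule vertex_action[OF assms(1)])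
  have a': "inv\<^bsub>G i\<^esub> a \<in> carrier (G i)" using assms(2) by simp
  show "vact i (inv\<^bsub>G i\<^esub> a) (vact i a x) = x"
    using vact_mult[OF assms(1) a' assms(2,3)] vact_one[OF assms(1,3)] assms(2) by simp
  show "vact i a (vact i (inv\<^bsub>G i\<^esub> a) x) = x"
    using vact_mult[OF assms(1,2) a' assms(3)] vact_one[OF assms(1,3)] assms(2) by simp
qed

lemma run_inj:
  "\<lbrakk>us \<in> lists letters; x \<in> configs (Suc n); y \<in> configs (Suc n); run us x = run us y\<rbrakk> \<Longrightarrow> x = y"
proof (induction us arbitrary: x y)
  case (Cons u us)
  obtain i a where u: "u = (i, a)" "i \<in> V" "a \<in> carrier (G i)"
    using Cons.prems by (auto simp: letters_def)
  have "vact i a x = vact i a y"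
    using Cons u vact_closed[OF u(2,3)] by auto
  then show ?case using vact_inv(1)[OF u(2,3)] Cons.prems by metis
qed simp

text \<open>Allows a configuration to be prescribed after a prefix of the word has acted, instead of
  at the start.\<close>

lemma run_surj:
  "\<lbrakk>us \<in> lists letters; y \<in> configs (Suc n)\<rbrakk> \<Longrightarrow> \<exists>x\<in>configs (Suc n). run us x = y"
proof (induction us arbitrary: y)
  case (Cons u us)
  obtain i a where u: "u = (i, a)" "i \<in> V" "a \<in> carrier (G i)"
    using Cons.prems by (auto simp: letters_def)
  interpret A: faithful_shift_action n "G i" "\<phi> i"
    by (rule vertex_action[OF u(2)])
  obtain x where x: "x \<in> configs (Suc n)" "run us x = y" using Cons by auto
  have "vact i (inv\<^bsub>G i\<^esub> a) x \<in> configs (Suc n)" "vact i a (vact i (inv\<^bsub>G i\<^esub> a) x) = x"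
    using u x vact_closed[OF u(2)] vact_inv(2)[OF u(2,3)] by auto
  then show ?case using x u(1) by (intro bexI[of _ "vact i (inv\<^bsub>G i\<^esub> a) x"]) auto
qed auto

text \<open>Ownership depends on the separators alone and so persists; only letters of the owner can
  change the value at \<open>p\<close>.\<close>

lemma run_other:
  assumes "us \<in> lists letters" "x \<in> configs (Suc n)" "owner (kind x p) = Some i" "i \<notin> fst ` set us"
  shows "run us x p = x p"
  using assms
proof (induction us arbitrary: x rule: list.induct)
  case (Cons u us)
  obtain j a where u: "u = (j, a)" "j \<in> V" "a \<in> carrier (G j)" "j \<noteq> i"
    using Cons.prems by (cases u) (force simp: letters_def)
  have *: "vact j a x \<in> configs (Suc n)" "kind (vact j a x) = kind x"
    using u Cons.prems vact_closed same_hash_kind[OF same_hash_vact] by auto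
  then have "run us (vact j a x) p = vact j a x p"
    using Cons by simp
  also have "\<dots> = x p" using Cons.prems u by (intro vact_other) simp
  finally show ?case by (simp add: u)
qed simp

end

text \<open>\<open>block\<close> puts the run \<open>w 0 \<dots> w L\<close> of letters of \<open>j\<close> in front of the configuration \<open>t\<close>, whose
  first letter controls whether the last letter \<open>w L\<close> takes part in the run.\<close>

locale control_block = graph_shift V E G n \<phi> N dec
  for V :: "'v set" and E :: "'v set set" and G :: "'v \<Rightarrow> ('g, 'm) monoid_scheme" and n :: nat
    and \<phi> :: "'v \<Rightarrow> 'g \<Rightarrow> (nat \<Rightarrow> nat) \<Rightarrow> nat \<Rightarrow> nat" and N dec +
  fixes j :: 'v and c dI dF L :: nat and w t :: "nat \<Rightarrow> nat"
  assumes j: "j \<in> V" and dI: "dI < N" "dec dI = Inner j" and dF: "dF < N" "dec dF = Final j c"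
    and w: "w \<in> configs n" and t: "t \<in> configs (Suc n)" "t 0 \<noteq> n" "controls j (kind t 0)"
begin

text \<open>Consecutive letters of the run are \<open>s\<close> apart, with \<open>dI\<close>
  separators between them. The configuration \<open>t\<close> starts at position \<open>K\<close>,
  after the last letter and its \<open>dF\<close> separators.\<close>

definition s :: nat where "s = Suc dI"
definition K :: nat where "K = L * s + Suc dF"

definition block :: "nat \<Rightarrow> nat" where
  "block p = (if p < K then (if p mod s = 0 \<and> p \<le> L * s then w (p div s) else n) else t (p - K))"

section \<open>Geometry of a block\<close>

lemma s_pos: "s > 0" by (simp add: s_def)

lemma block_closed: "block \<in> configs (Suc n)"
  using w t(1) by (auto simp: block_def configs_def less_SucI)

lemma letter_less_K: "k \<le> L \<Longrightarrow> k * s < K"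
  using mult_le_mono1[of k L s] unfolding K_def by linarith

lemma block_letter: "k \<le> L \<Longrightarrow> block (k * s) = w k"
  using letter_less_K[of k] s_pos by (simp add: block_def)

lemma block_shift: "(\<lambda>p. block (p + K)) = t"
  by (simp add: block_def)

lemma block_hash:
  assumes "p < K" "block p \<noteq> n"
  shows "\<exists>k\<le>L. p = k * s"
proof -
  have "p mod s = 0" "p \<le> L * s" using assms by (auto simp: block_def split: if_splits)
  then have "p = p div s * s" "p div s \<le> L"
    using s_pos div_le_mono[of p "L * s" s] by auto
  then show ?thesis by blast
qed

lemma gap_block_Inner:
  assumes "k < L"
  shows "gap block (k * s) = dI"
proof (rule gap_eqI)
  have "block (Suc k * s) \<noteq> n"
    using block_letter[of "Suc k"] assms w by (simp add: configs_def less_imp_neq)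
  then show "dI = N \<or> block (k * s + Suc dI) \<noteq> n" by (simp add: s_def algebra_simps)
  fix e assume e: "e < dI"
  then have "(k * s + Suc e) mod s \<noteq> 0" unfolding mod_mult_self3 by (simp add: s_def)
  moreover have "k * s + Suc e < K"
    using letter_less_K[of "Suc k"] assms e by (simp add: s_def)
  ultimately show "block (k * s + Suc e) = n" by (simp add: block_def)
qed (use dI in simp)

lemma gap_block_Final: "gap block (L * s) = dF"
proof (rule gap_eqI)
  show "dF = N \<or> block (L * s + Suc dF) \<noteq> n" using t(2) by (simp add: block_def K_def)
qed (use dF in \<open>auto simp: block_def K_def\<close>)

section \<open>Facts shared by all configurations with the separators of the block\<close>

context
  fixes z assumes z: "same_hash block z"
begin

lemma kind_Inner: "k < L \<Longrightarrow> kind z (k * s) = Inner j"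
  using dI gap_block_Inner[of k] same_hash_gap[OF z] by (simp add: kind_def)

lemma kind_Final: "kind z (L * s) = Final j c"
  using dF gap_block_Final same_hash_gap[OF z] by (simp add: kind_def)

lemma nxt_Inner: "k < L \<Longrightarrow> nxt z (k * s) = Suc k * s"
  using gap_block_Inner[of k] same_hash_nxt[OF z] by (simp add: nxt_def fun_eq_iff s_def)

lemma nxt_Final: "nxt z (L * s) = K"
  using gap_block_Final same_hash_nxt[OF z] by (simp add: nxt_def fun_eq_iff K_def)

lemma letter_not_hash: "k \<le> L \<Longrightarrow> z (k * s) \<noteq> n"
  using z block_letter[of k] w by (simp add: same_hash_def configs_def) (metis less_irrefl)

lemma kind_K: "kind z K = kind t 0"
proof -
  have "same_hash t (\<lambda>p. z (p + K))"
    using z block_shift unfolding same_hash_def by metis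
  from same_hash_gap[OF this] have "gap t 0 = gap (\<lambda>p. z (p + K)) 0" by simp
  also have "\<dots> = gap z K" by (simp add: gap_def add.commute)
  finally show ?thesis by (simp add: kind_def)
qed

lemma active_Inner: "k < L \<Longrightarrow> active j z (k * s)"
  using kind_Inner[of k] letter_not_hash[of k] by (simp add: active_def)

lemma active_Final: "active j z (L * s) \<longleftrightarrow> z K = c"
  using kind_Final letter_not_hash[of L] t(3) by (auto simp: active_def nxt_Final kind_K)

lemma owner_letter: "k \<le> L \<Longrightarrow> owner (kind z (k * s)) = Some j"
  using kind_Inner[of k] kind_Final by (cases "k = L") auto

text \<open>Stepping proceeds letter by letter to the end of the run, which is letter
  \<open>L\<close> or \<open>L - 1\<close> according to the control at \<open>K\<close>. The maximum
  with \<open>k\<close> accounts for starting at letter \<open>L\<close> when it is inactive, where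
  \<open>step\<close> does not move.\<close>

lemma funpow_step_letter:
  assumes "k \<le> L"
  shows "(step j z ^^ m) (k * s) = min (m + k) (max k (if z K = c then L else L - 1)) * s"
proof (induction m)
  case 0
  then show ?case by (simp add: min_def)
next
  case (Suc m)
  define M where "M = max k (if z K = c then L else L - 1)"
  define k' where "k' = min (m + k) M"
  have k': "k' \<le> L" using assms by (auto simp: k'_def M_def)
  have "step j z (k' * s) = min (Suc m + k) M * s"
  proof (cases "k' < L")
    case True
    have "active j z (Suc k' * s) \<longleftrightarrow> Suc k' < L \<or> z K = c"
      using True active_Inner[of "Suc k'"] active_Final by (cases "Suc k' = L") auto
    then have "active j z (Suc k' * s) \<longleftrightarrow> Suc k' \<le> M"
      using True assms by (auto simp: k'_def M_def min_def max_def split: if_splits)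
    moreover have "step j z (k' * s) = (if active j z (Suc k' * s) then Suc k' * s else k' * s)"
      using kind_Inner[OF True] nxt_Inner[OF True] by (simp add: step_def)
    ultimately show ?thesis by (auto simp: k'_def min_def)
  next
    case False
    then have "k' = L" using k' by simp
    then have "step j z (k' * s) = L * s" using kind_Final by (simp add: step_def)
    moreover have "min (Suc m + k) M = L"
      using \<open>k' = L\<close> assms by (auto simp: k'_def M_def min_def max_def split: if_splits)
    ultimately show ?thesis by simp
  qed
  then show ?case using Suc by (simp add: k'_def M_def)
qed

end

text \<open>All letters of the block belong to \<open>j\<close>, so other vertices change nothing
  there, and the action of \<open>j\<close> sees of the positions from \<open>K\<close> on only the
  control letter at \<open>K\<close>.\<close>

lemma vact_agree_below:
  assumes z: "same_hash block z" "same_hash block z'" and eq: "\<forall>p<K. z p = z' p"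
    and eqK: "i = j \<Longrightarrow> z K = z' K" and p: "p < K"
  shows "vact i a z p = vact i a z' p"
proof (cases "block p = n")
  case True
  then have "z p = n" "z' p = n" using z by (auto simp: same_hash_def)
  then show ?thesis by (simp add: vact_def active_def)
next
  case False
  then obtain k where k: "k \<le> L" "p = k * s" using block_hash[OF p] by blast
  show ?thesis
  proof (cases "i = j")
    case False
    then show ?thesis
      using owner_letter[OF z(1) k(1)] owner_letter[OF z(2) k(1)] eq p k by (simp add: vact_other)
  next
    case True
    have "active j z p = active j z' p"
      using active_Inner[OF z(1), of k] active_Inner[OF z(2), of k] active_Final[OF z(1)]
        active_Final[OF z(2)] k eqK[OF True] by (cases "k = L") auto
    moreover have "track j z p = track j z' p"
    proof
      fix m
      let ?k = "min (m + k) (max k (if z K = c then L else L - 1))"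
      have "?k \<le> L" using k by auto
      then have "z (?k * s) = z' (?k * s)" using eq letter_less_K by blast
      then show "track j z p m = track j z' p m"
        unfolding track_def k(2) funpow_step_letter[OF z(1) k(1)] funpow_step_letter[OF z(2) k(1)]
        using eqK[OF True] by simp
    qed
    ultimately show ?thesis using True eq p by (simp add: vact_def cong: if_cong)
  qed
qed

text \<open>The run has \<open>L + 1\<close> letters if the control matches and \<open>L\<close>
  letters otherwise; for \<open>L = 0\<close> the latter means that the first letter is inactive.
  These are the two sides compared in \<open>act_truncation\<close>.\<close>

lemma vact_block_start:
  assumes z: "same_hash block z" and eq: "\<And>k. k \<le> L \<Longrightarrow> z (k * s) = w k"
  shows "vact j h z 0 = (if z K = c then \<phi> j h (\<lambda>m. w (min m L)) 0
     else if L = 0 then w 0 else \<phi> j h (\<lambda>m. w (min m (L - 1))) 0)"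
proof -
  have tr: "track j z 0 = (\<lambda>m. w (min m (if z K = c then L else L - 1)))"
    unfolding track_def using funpow_step_letter[OF z, of 0] by (auto simp: eq)
  have "active j z 0 \<longleftrightarrow> L \<noteq> 0 \<or> z K = c"
    using active_Inner[OF z, of 0] active_Final[OF z] by (cases "L = 0") auto
  then show ?thesis using eq[of 0] by (auto simp: vact_def tr)
qed

end

section \<open>Propagating a difference along a reduced word\<close>

context graph_shift
begin

text \<open>Letters act in the order of the list. The first letters of \<open>x\<close> and \<open>x'\<close> agree at all times
  until \<open>(i, g)\<close> makes them differ.\<close>

definition diverging ::
  "('v \<times> 'g) list \<Rightarrow> 'v \<Rightarrow> 'g \<Rightarrow> (nat \<Rightarrow> nat) \<Rightarrow> (nat \<Rightarrow> nat) \<Rightarrow> bool" where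
  "diverging pre i g x x' \<longleftrightarrow> x \<in> configs (Suc n) \<and> x' \<in> configs (Suc n) \<and> same_hash x x' \<and>
     x 0 \<noteq> n \<and> owner (kind x 0) = Some i \<and>
     (\<forall>q q'. pre = q @ q' \<longrightarrow> run q x 0 = run q x' 0) \<and>
     run (pre @ [(i, g)]) x 0 \<noteq> run (pre @ [(i, g)]) x' 0"

text \<open>One link of the chain: a block of \<open>j\<close> is put in front of \<open>x\<close>
  and \<open>x'\<close>, whose first letters act as its control. Letters of \<open>j\<close> in
  \<open>pre\<close> act only while the controls agree, so the difference first enters the block
  when \<open>(j, h)\<close> acts.\<close>

lemma ex_diverging:
  assumes pre: "pre \<in> lists letters" and j: "j \<in> V" "h \<in> carrier (G j)" "h \<noteq> \<one>\<^bsub>G j\<^esub>"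
    and x: "x \<in> configs (Suc n)" "x' \<in> configs (Suc n)" "same_hash x x'" "x 0 \<noteq> n" "controls j (kind x 0)"
    and agree: "\<And>q b q'. pre = q @ (j, b) # q' \<Longrightarrow> run q x 0 = run q x' 0"
    and differ: "run pre x 0 \<noteq> run pre x' 0"
  shows "\<exists>y y'. diverging pre j h y y'"
proof -
  interpret A: faithful_shift_action n "G j" "\<phi> j" by (rule vertex_action[OF j(1)])
  obtain w L where w: "w \<in> configs n"
    and wL: "(if L = 0 then w 0 else \<phi> j h (\<lambda>m. w (min m (L - 1))) 0) \<noteq> \<phi> j h (\<lambda>m. w (min m L)) 0"
    using A.act_truncation[OF j(2,3)] by metis
  \<comment> \<open>The control value is the first letter of \<open>x'\<close> after
    \<open>pre\<close>. At that time the last letter of the block is active in \<open>y'\<close> but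
    not in \<open>y\<close>.\<close>
  define t c where "t = run pre x" and "c = run pre x' 0"
  have xt: "same_hash x t" and tC: "t \<in> configs (Suc n)"
    using same_hash_run run_closed pre x(1) by (auto simp: t_def)
  have "run pre x' \<in> configs (Suc n)" "same_hash x (run pre x')"
    using same_hash_run run_closed pre x(2,3) same_hash_trans by blast+
  then have c: "c < n"
    using x(4) by (auto simp: c_def configs_def same_hash_def less_Suc_eq)
  obtain dI dF where d: "dI < N" "dec dI = Inner j" "dF < N" "dec dF = Final j c"
    using dec_Inner[OF j(1)] dec_Final[OF j(1) c] by blast
  interpret B: control_block V E G n \<phi> N dec j c dI dF L w t
    by unfold_locales (use j d w tC xt x(4,5) same_hash_kind[OF xt] in \<open>auto simp: same_hash_def\<close>)
  \<comment> \<open>The block should be intact when \<open>(j, h)\<close> acts, so it is prescribed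
    after \<open>pre\<close>, and \<open>y\<close> is obtained by undoing
    \<open>pre\<close>.\<close>
  obtain y where y: "y \<in> configs (Suc n)" "run pre y = B.block"
    using run_surj[OF pre B.block_closed] by blast
  \<comment> \<open>Beyond the block \<open>y\<close> has to be \<open>x\<close>, since
    \<open>run pre\<close> commutes with shifts and is injective.\<close>
  have yx: "(\<lambda>p. y (p + B.K)) = x"
  proof (rule run_inj[OF pre])
    show "(\<lambda>p. y (p + B.K)) \<in> configs (Suc n)" using y(1) by (simp add: configs_def)
    show "run pre (\<lambda>p. y (p + B.K)) = run pre x"
      unfolding run_shift y(2) by (simp only: B.block_shift) (simp add: t_def)
  qed (rule x)
  define y' where "y' = (\<lambda>p. if p < B.K then y p else x' (p - B.K))"
  have y'x: "(\<lambda>p. y' (p + B.K)) = x'" by (simp add: y'_def)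
  have y'C: "y' \<in> configs (Suc n)" using y(1) x(2) by (auto simp: y'_def configs_def)
  have yx': "y p = x (p - B.K)" if "p \<ge> B.K" for p
    using fun_cong[OF yx, of "p - B.K"] that by simp
  have hyy': "same_hash y y'"
    using x(3) by (auto simp: same_hash_def y'_def yx')
  have hy: "same_hash B.block y"
    using same_hash_run[OF pre y(1)] y(2) by (simp add: same_hash_sym)
  have at_K: "run q y B.K = run q x 0" "run q y' B.K = run q x' 0" for q
    using fun_cong[OF run_shift[of q y B.K], of 0] fun_cong[OF run_shift[of q y' B.K], of 0]
    by (simp_all add: yx y'x)
  have hq: "same_hash B.block (run q y)" "same_hash B.block (run q y')" if "pre = q @ q'" for q q'
    using that pre same_hash_run[of q] y(1) y'C hy hyy' by (auto intro: same_hash_trans)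
  \<comment> \<open>Induction over the prefixes of \<open>pre\<close>: the two blocks start equal,
    and each letter of the word preserves this by \<open>vact_agree_below\<close>.\<close>
  have below: "\<forall>p<B.K. run q y p = run q y' p" if "pre = q @ q'" for q q'
    using that
  proof (induction q arbitrary: q' rule: rev_induct)
    case Nil
    then show ?case by (simp add: y'_def)
  next
    case (snoc u q)
    obtain i b where u: "u = (i, b)" by (cases u)
    have split: "pre = q @ (i, b) # q'" using snoc.prems u by simp
    have "vact i b (run q y) p = vact i b (run q y') p" if "p < B.K" for p
    proof (rule B.vact_agree_below[OF hq[OF split] snoc.IH[OF split] _ that])
      assume "i = j"
      then show "run q y B.K = run q y' B.K" using agree split at_K by simp
    qed
    then show ?case by (simp add: u)
  qed
  have "vact j h (run pre y) 0 \<noteq> vact j h (run pre y') 0"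
  proof -
    have s: "same_hash B.block (run pre y)" "same_hash B.block (run pre y')" by (rule hq[of pre "[]"]; simp)+
    have "run pre y (k * B.s) = w k" "run pre y' (k * B.s) = w k" if "k \<le> L" for k
      using below[of pre "[]"] B.letter_less_K[OF that] B.block_letter[OF that] y(2) by simp_all
    then show ?thesis
      unfolding B.vact_block_start[OF s(1)] B.vact_block_start[OF s(2)]
      using wL differ at_K by (simp add: B.vact_block_start[OF s(1)] B.vact_block_start[OF s(2)] c_def)
  qed
  then have "run (pre @ [(j, h)]) y 0 \<noteq> run (pre @ [(j, h)]) y' 0" by simp
  moreover have "run q y 0 = run q y' 0" if "pre = q @ q'" for q q'
    using below[OF that] B.letter_less_K[of 0] by simp
  moreover have "y 0 \<noteq> n" "owner (kind y 0) = Some j"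
    using B.letter_not_hash[OF hy, of 0] B.owner_letter[OF hy, of 0] by simp_all
  ultimately have "diverging pre j h y y'"
    using y(1) y'C hyy' by (simp add: diverging_def)
  then show ?thesis by blast
qed

text \<open>The chain starts from a single letter 0 or 1 followed by separators forever. It is
  \<open>Inert\<close> and hence a static control; \<open>n \<ge> 2\<close> makes both values
  available.\<close>

lemma ex_diverging_start:
  assumes "j \<in> V" "h \<in> carrier (G j)" "h \<noteq> \<one>\<^bsub>G j\<^esub>"
  shows "\<exists>y y'. diverging [] j h y y'"
proof -
  define x :: "nat \<Rightarrow> nat \<Rightarrow> nat" where "x = (\<lambda>c p. if p = 0 then c else n)"
  have "gap (x c) 0 = N" for c by (rule gap_eqI) (auto simp: x_def)
  then have "kind (x c) 0 = Inert" for c by (simp add: kind_def dec_Inert)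
  then show ?thesis
    using n_ge_2 assms
    by (intro ex_diverging[where x = "x 0" and x' = "x 1"])
      (auto simp: x_def configs_def same_hash_def controls_def)
qed

text \<open>Induction on the length of the rest of the word. If some later letter does not commute
  with \<open>(i, g)\<close>, the first such letter continues the chain. Otherwise nothing can undo
  the difference at position 0.\<close>

lemma diverging_imp_nontrivial:
  assumes us: "us \<in> lists letters" "reduced us"
  shows "us = pre @ (i, g) # post \<Longrightarrow> diverging pre i g y y' \<Longrightarrow> \<exists>x\<in>configs (Suc n). run us x \<noteq> x"
proof (induction post arbitrary: pre i g y y' rule: measure_induct_rule[where f = length])
  case (less post)
  have div: "y \<in> configs (Suc n)" "y' \<in> configs (Suc n)" "same_hash y y'" "y 0 \<noteq> n"
    "owner (kind y 0) = Some i" "\<And>q q'. pre = q @ q' \<Longrightarrow> run q y 0 = run q y' 0"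
    "run (pre @ [(i, g)]) y 0 \<noteq> run (pre @ [(i, g)]) y' 0"
    using less.prems(2) by (auto simp: diverging_def)
  have mem: "pre @ [(i, g)] \<in> lists letters" "post \<in> lists letters"
    using us(1) less.prems(1) by auto
  have owner': "owner (kind (run (pre @ [(i, g)]) z) 0) = Some i" if "z = y \<or> z = y'" for z
  proof -
    have "same_hash y z" "z \<in> configs (Suc n)" using that div by auto
    then have "same_hash y (run (pre @ [(i, g)]) z)"
      using same_hash_run[OF mem(1)] same_hash_trans by blast
    then show ?thesis using same_hash_kind div(5) by metis
  qed
  have unchanged: "run (pre @ (i, g) # mid) z 0 = run (pre @ [(i, g)]) z 0"
    if "z = y \<or> z = y'" "mid \<in> lists letters" "i \<notin> fst ` set mid" for z mid
    using run_other[OF that(2) run_closed[OF mem(1)] owner' that(3), of z] that div by auto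
  have no_i: "i \<notin> fst ` set mid"
    \<comment> \<open>As the word is reduced, \<open>i\<close> cannot recur before a letter that
      blocks it.\<close>
    if "post = mid @ rest" "\<forall>j\<in>fst ` set mid. j = i \<or> {i, j} \<in> E" for mid rest
  proof
    assume "i \<in> fst ` set mid"
    then obtain b m1 m2 where "mid = m1 @ (i, b) # m2" by (auto dest: split_list)
    then have "us = pre @ (i, g) # m1 @ (i, b) # (m2 @ rest)" "set m1 \<subseteq> set mid"
      using less.prems(1) that(1) by auto
    then show False using reducedD us(2) that(2) by blast
  qed
  show ?case
  proof (cases "\<exists>j\<in>fst ` set post. j \<noteq> i \<and> {i, j} \<notin> E")
    case False
    then have "i \<notin> fst ` set post" using no_i[of post "[]"] by auto
    then have "run us y 0 \<noteq> run us y' 0"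
      using unchanged[of _ post] mem(2) less.prems(1) div(7) by simp
    \<comment> \<open>The first letters of \<open>y\<close> and \<open>y'\<close> agree initially
      but differ at the end, so the word moves at least one of the two configurations.\<close>
    then have "run us y \<noteq> y \<or> run us y' \<noteq> y'" using div(6)[of "[]"] by auto
    then show ?thesis using div by blast
  next
    case True
    then have "\<exists>u\<in>set post. fst u \<noteq> i \<and> {i, fst u} \<notin> E" by auto
    then obtain mid u post' where post: "post = mid @ u # post'" "fst u \<noteq> i \<and> {i, fst u} \<notin> E"
      "\<forall>u\<in>set mid. \<not> (fst u \<noteq> i \<and> {i, fst u} \<notin> E)"
      by (rule split_list_first_propE)
    obtain j h where u: "u = (j, h)" by (cases u)
    have i_mid: "i \<notin> fst ` set mid" using no_i[OF post(1)] post(3) by auto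
    have j_mid: "j \<notin> fst ` set mid" using post u by auto
    have us_eq: "us = (pre @ (i, g) # mid) @ (j, h) # post'"
      using less.prems(1) post(1) u by simp
    have mid: "mid \<in> lists letters" "pre @ (i, g) # mid \<in> lists letters" "j \<in> V" "h \<in> carrier (G j)"
      using us(1) us_eq by (auto simp: letters_def)
    have h: "h \<noteq> \<one>\<^bsub>G j\<^esub>" using us(2) us_eq by (auto simp: reduced_def)
    have "controls j (kind y 0)"
      using div(5) post u by (auto simp: controls_def insert_commute)
    moreover have "run q y 0 = run q y' 0" if split: "pre @ (i, g) # mid = q @ (j, b) # q'" for q b q'
    proof -
      have "(j, b) \<notin> set ((i, g) # mid)" using j_mid post(2) u by force
      moreover obtain r where "pre = q @ r \<or> (i, g) # mid = r @ (j, b) # q'"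
        using split[unfolded append_eq_append_conv2] by blast
      ultimately have "pre = q @ r" by (metis in_set_conv_decomp)
      then show ?thesis by (rule div(6))
    qed
    moreover have "run (pre @ (i, g) # mid) y 0 \<noteq> run (pre @ (i, g) # mid) y' 0"
      using unchanged[OF _ mid(1) i_mid] div(7) by simp
    ultimately obtain z z' where zz': "diverging (pre @ (i, g) # mid) j h z z'"
      using ex_diverging[OF mid(2-4) h div(1-4)] by blast
    show ?thesis by (rule less.IH[OF _ us_eq zz']) (simp add: post(1))
  qed
qed

lemma reduced_nontrivial:
  assumes "us \<in> lists letters" "reduced us" "us \<noteq> []"
  shows "\<exists>x\<in>configs (Suc n). run us x \<noteq> x"
proof -
  obtain i g post where us: "us = (i, g) # post" using assms(3) by (cases us) auto
  then have "i \<in> V" "g \<in> carrier (G i)" "g \<noteq> \<one>\<^bsub>G i\<^esub>"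
    using assms by (auto simp: letters_def reduced_def)
  then obtain y y' where "diverging [] i g y y'" using ex_diverging_start by blast
  then show ?thesis using diverging_imp_nontrivial[OF assms(1,2), of "[]"] us by simp
qed

end

section \<open>The graph product acts\<close>

context graph_shift
begin

fun letter_act :: "('v \<times> 'g) \<times> bool \<Rightarrow> (nat \<Rightarrow> nat) \<Rightarrow> nat \<Rightarrow> nat" where
  "letter_act ((i, a), b) = vact i (if b then a else inv\<^bsub>G i\<^esub> a)"

definition word_act :: "('v \<times> 'g) gword \<Rightarrow> (nat \<Rightarrow> nat) \<Rightarrow> nat \<Rightarrow> nat" where
  "word_act = foldr letter_act"

lemma word_act_Nil [simp]: "word_act [] x = x"
  and word_act_Cons [simp]: "word_act (l # w) x = letter_act l (word_act w x)"
  and word_act_append: "word_act (u @ w) x = word_act u (word_act w x)"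
  by (simp_all add: word_act_def)

lemma letter_cases:
  assumes "l \<in> letters \<times> UNIV"
  obtains i a where "i \<in> V" "a \<in> carrier (G i)" "letter_act l = vact i a"
proof -
  obtain i a b where l: "l = ((i, a), b)" "i \<in> V" "a \<in> carrier (G i)"
    using assms by (auto simp: letters_def)
  interpret group "G i" by (rule group_vertex[OF l(2)])
  show thesis using that[of i "if b then a else inv\<^bsub>G i\<^esub> a"] l by simp
qed

lemma word_act_closed: "\<lbrakk>w \<in> gwords letters; x \<in> configs (Suc n)\<rbrakk> \<Longrightarrow> word_act w x \<in> configs (Suc n)"
proof (induction w)
  case (Cons l w)
  then have l: "l \<in> letters \<times> UNIV" "word_act w x \<in> configs (Suc n)" by (auto simp: gwords_def)
  show ?case by (rule letter_cases[OF l(1)]) (simp add: vact_closed l(2))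
qed simp

lemma word_act_shift: "w \<in> gwords letters \<Longrightarrow> word_act w (shift_map x) = shift_map (word_act w x)"
proof (induction w)
  case (Cons l w)
  then have l: "l \<in> letters \<times> UNIV" "w \<in> gwords letters" by (auto simp: gwords_def)
  show ?case by (rule letter_cases[OF l(1)]) (simp add: vact_shift Cons.IH[OF l(2)])
qed simp

lemma vact_continuous:
  assumes "i \<in> V" "a \<in> carrier (G i)"
  shows "continuous_map (full_shift {..<Suc n}) (full_shift {..<Suc n}) (vact i a)"
proof -
  obtain R where "\<forall>x\<in>configs (Suc n). \<forall>y\<in>configs (Suc n). (\<forall>q<R. x q = y q) \<longrightarrow> vact i a x 0 = vact i a y 0"
    using vact_local[OF assms] by blast
  then show ?thesis
    using vact_closed[OF assms] vact_shift by (intro local_imp_continuous_map[where r = R]) blast+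
qed

lemma word_act_continuous:
  "w \<in> gwords letters \<Longrightarrow> continuous_map (full_shift {..<Suc n}) (full_shift {..<Suc n}) (word_act w)"
proof (induction w)
  case Nil
  then show ?case by (simp add: word_act_def)
next
  case (Cons l w)
  then have l: "l \<in> letters \<times> UNIV" "w \<in> gwords letters" by (auto simp: gwords_def)
  obtain i a where "i \<in> V" "a \<in> carrier (G i)" "letter_act l = vact i a"
    using letter_cases[OF l(1)] .
  moreover have "word_act (l # w) = letter_act l \<circ> word_act w" by (simp add: word_act_def)
  ultimately show ?case
    using continuous_map_compose[OF Cons.IH[OF l(2)] vact_continuous] by metis
qed

lemma word_act_cancel:
  assumes "s \<in> letters" "x \<in> configs (Suc n)"
  shows "word_act [(s, b), (s, \<not> b)] x = x"
proof -
  obtain i a where "s = (i, a)" "i \<in> V" "a \<in> carrier (G i)" using assms(1) by (auto simp: letters_def)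
  then show ?thesis using vact_inv[of i a x] assms(2) by (cases b) auto
qed

lemma word_act_relator:
  assumes r: "r \<in> graph_product_relators V E G" and x: "x \<in> configs (Suc n)"
  shows "word_act r x = x"
proof -
  consider (one) i where "r = [((i, \<one>\<^bsub>G i\<^esub>), True)]" "i \<in> V"
    | (mult) i a b where "r = [((i, a), True), ((i, b), True), ((i, a \<otimes>\<^bsub>G i\<^esub> b), False)]"
        "i \<in> V" "a \<in> carrier (G i)" "b \<in> carrier (G i)"
    | (commute) i j a b where "r = [((i, a), True), ((j, b), True), ((i, a), False), ((j, b), False)]"
        "i \<in> V" "j \<in> V" "{i, j} \<in> E" "a \<in> carrier (G i)" "b \<in> carrier (G j)"
    using r unfolding graph_product_relators_def by blast
  then show ?thesis
  proof cases
    case one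
    then show ?thesis using vact_one x by simp
  next
    case mult
    interpret group "G i" by (rule group_vertex[OF mult(2)])
    let ?c = "a \<otimes>\<^bsub>G i\<^esub> b"
    have c: "?c \<in> carrier (G i)" "inv\<^bsub>G i\<^esub> ?c \<in> carrier (G i)" using mult by simp_all
    let ?y = "vact i (inv\<^bsub>G i\<^esub> ?c) x"
    have "vact i a (vact i b ?y) = vact i ?c ?y"
      using vact_mult[OF mult(2-4) vact_closed[OF mult(2) c(2) x]] by simp
    also have "\<dots> = x" by (rule vact_inv(2)[OF mult(2) c(1) x])
    finally show ?thesis by (simp add: mult(1))
  next
    case commute
    interpret Gi: group "G i" by (rule group_vertex[OF commute(2)])
    interpret Gj: group "G j" by (rule group_vertex[OF commute(3)])
    let ?a' = "inv\<^bsub>G i\<^esub> a" and ?b' = "inv\<^bsub>G j\<^esub> b"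
    have inv: "?a' \<in> carrier (G i)" "?b' \<in> carrier (G j)" using commute by simp_all
    have y: "vact j ?b' x \<in> configs (Suc n)" by (rule vact_closed[OF commute(3) inv(2) x])
    have "vact j b (vact i ?a' (vact j ?b' x)) = vact i ?a' (vact j b (vact j ?b' x))"
      using vact_commute[OF commute(2-4) inv(1) commute(6) y] by simp
    also have "\<dots> = vact i ?a' x" using vact_inv(2)[OF commute(3,6) x] by simp
    finally show ?thesis using vact_inv(2)[OF commute(2,5) x] by (simp add: commute(1))
  qed
qed

lemma word_act_cong: "\<lbrakk>u \<approx>\<^sub>w v; x \<in> configs (Suc n)\<rbrakk> \<Longrightarrow> word_act u x = word_act v x"
proof (induction rule: pres_rel.induct)
  case (cancel u v s b)
  have "word_act [(s, b), (s, \<not> b)] (word_act v x) = word_act v x"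
    using cancel word_act_closed by (intro word_act_cancel) auto
  then show ?case by (simp add: word_act_append)
next
  case (relator u v r)
  have "word_act r (word_act v x) = word_act v x"
    using relator word_act_closed by (intro word_act_relator) auto
  then show ?case by (simp add: word_act_append)
qed simp_all

definition class_act :: "('v \<times> 'g) gword set \<Rightarrow> (nat \<Rightarrow> nat) \<Rightarrow> nat \<Rightarrow> nat" where
  "class_act A = word_act (SOME w. w \<in> A)"

abbreviation word_class :: "('v \<times> 'g) gword \<Rightarrow> ('v \<times> 'g) gword set" where
  "word_class w \<equiv> pres_rel letters (graph_product_relators V E G) `` {w}"

lemma graph_product_eq: "graph_product V E G = presented_group letters (graph_product_relators V E G)"
  by (simp add: graph_product_def letters_def)

lemma carrier_graph_product:
  assumes "A \<in> carrier (graph_product V E G)"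
  obtains w where "w \<in> gwords letters" "A = word_class w"
  using assms by (auto simp: graph_product_eq presented_group_def elim: quotientE)

lemma class_act_word_class:
  assumes "w \<in> gwords letters" "x \<in> configs (Suc n)"
  shows "class_act (word_class w) x = word_act w x"
proof -
  have "w \<in> word_class w" using assms(1) by (simp add: pres_rel.refl)
  then have "(SOME w'. w' \<in> word_class w) \<in> word_class w" by (rule someI)
  then have "w \<approx>\<^sub>w (SOME w'. w' \<in> word_class w)" by simp
  from word_act_cong[OF this assms(2)] show ?thesis by (simp add: class_act_def)
qed

lemma word_act_pos: "word_act (pos us) x = run (rev us) x"
  by (induction us) auto

lemma word_act_faithful:
  assumes w: "w \<in> gwords letters" "word_class w \<noteq> word_class []"
  shows "\<exists>x\<in>configs (Suc n). word_act w x \<noteq> x"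
proof -
  obtain us where us: "us \<in> lists letters" "reduced us" "w \<approx>\<^sub>w pos us"
    using ex_reduced[OF w(1)] by blast
  have "word_class w = word_class (pos us)"
    by (rule equiv_class_eq[OF equiv_pres_rel us(3)])
  then have "us \<noteq> []" using w(2) by force
  moreover have "rev us \<in> lists letters" using us(1) by auto
  ultimately obtain x where "x \<in> configs (Suc n)" "run (rev us) x \<noteq> x"
    using reduced_nontrivial reduced_rev[OF us(2)] by blast
  then show ?thesis using word_act_cong[OF us(3)] word_act_pos by metis
qed

lemma graph_product_action: "faithful_shift_action (Suc n) (graph_product V E G) class_act"
proof (intro faithful_shift_action.intro faithful_shift_action_axioms.intro)
  show "group (graph_product V E G)"
    unfolding graph_product_eq by (rule group_presented_group)
next
  fix A x assume A: "A \<in> carrier (graph_product V E G)" and x: "x \<in> configs (Suc n)"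
  obtain w where w: "w \<in> gwords letters" "A = word_class w" using carrier_graph_product[OF A] .
  show "class_act A x \<in> configs (Suc n)"
    unfolding w(2) class_act_word_class[OF w(1) x] by (rule word_act_closed[OF w(1) x])
  have "shift_map x \<in> configs (Suc n)" using x by (simp add: configs_def shift_map_def)
  then show "class_act A (shift_map x) = shift_map (class_act A x)"
    using w x by (simp only: class_act_word_class word_act_shift)
  fix B assume B: "B \<in> carrier (graph_product V E G)"
  obtain v where v: "v \<in> gwords letters" "B = word_class v" using carrier_graph_product[OF B] .
  have "B \<otimes>\<^bsub>graph_product V E G\<^esub> A = word_class (v @ w)"
    unfolding graph_product_eq w(2) v(2) by (rule presented_group_mult[OF v(1) w(1)])
  moreover have "v @ w \<in> gwords letters" using v(1) w(1) by simp
  ultimately show "class_act (B \<otimes>\<^bsub>graph_product V E G\<^esub> A) x = class_act B (class_act A x)"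
    using v w x word_act_closed[OF w(1) x] by (simp only: class_act_word_class word_act_append)
next
  fix x assume x: "x \<in> configs (Suc n)"
  have "\<one>\<^bsub>graph_product V E G\<^esub> = word_class []"
    by (simp add: graph_product_eq presented_group_def)
  then show "class_act \<one>\<^bsub>graph_product V E G\<^esub> x = x"
    using class_act_word_class[OF gwords_Nil x] by simp
next
  fix A assume A: "A \<in> carrier (graph_product V E G)"
  obtain w where w: "w \<in> gwords letters" "A = word_class w" using carrier_graph_product[OF A] .
  obtain r where "\<forall>x\<in>configs (Suc n). \<forall>y\<in>configs (Suc n). (\<forall>k<r. x k = y k) \<longrightarrow>
      word_act w x 0 = word_act w y 0"
    using continuous_map_imp_local[OF finite_lessThan word_act_continuous[OF w(1)]]
    unfolding topspace_full_shift_lessThan by blast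
  then have "class_act A x 0 = class_act A y 0"
    if "x \<in> configs (Suc n)" "y \<in> configs (Suc n)" "\<forall>k<r. x k = y k" for x y
    using that class_act_word_class[OF w(1)] w(2) by metis
  then show "\<exists>r. \<forall>x\<in>configs (Suc n). \<forall>y\<in>configs (Suc n). (\<forall>k<r. x k = y k) \<longrightarrow> class_act A x 0 = class_act A y 0"
    by blast
  assume "A \<noteq> \<one>\<^bsub>graph_product V E G\<^esub>"
  then have "word_class w \<noteq> word_class []"
    using w(2) by (simp add: graph_product_eq presented_group_def)
  then show "\<exists>x\<in>configs (Suc n). class_act A x \<noteq> x"
    using word_act_faithful[OF w(1)] class_act_word_class[OF w(1)] w(2) by metis
qed

end

lemma ex_letter_code:
  assumes "finite V"
  shows "\<exists>N (dec :: nat \<Rightarrow> 'v letter_type). dec N = Inert \<and> (\<forall>i\<in>V. \<exists>d<N. dec d = Inner i) \<and>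
    (\<forall>i\<in>V. \<forall>c<n. \<exists>d<N. dec d = Final i c)"
proof -
  have "finite (Inner ` V \<union> (\<lambda>(i, c). Final i c) ` (V \<times> {..<n}))" using assms by simp
  from finite_list[OF this] obtain ts
    where ts: "set ts = Inner ` V \<union> (\<lambda>(i, c). Final i c) ` (V \<times> {..<n})" ..
  define dec where "dec d = (if d < length ts then ts ! d else Inert)" for d
  have "\<exists>d<length ts. dec d = t" if "t \<in> set ts" for t
    using that by (auto simp: dec_def in_set_conv_nth)
  moreover have "dec (length ts) = Inert" by (simp add: dec_def)
  moreover have "Inner i \<in> set ts" "c < n \<Longrightarrow> Final i c \<in> set ts" if "i \<in> V" for i c
    using that by (auto simp: ts)
  ultimately show ?thesis
    by (intro exI[of _ "length ts"] exI[of _ dec]) blast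
qed

theorem theorem3:
  fixes n :: nat and V :: "'v set" and E :: "'v set set"
    and G :: "'v \<Rightarrow> ('g, 'm) monoid_scheme"
  assumes "n \<ge> 2"
    and "finite V"
    and "E \<subseteq> {{u, v} | u v. u \<in> V \<and> v \<in> V \<and> u \<noteq> v}"
    and "\<And>i. i \<in> V \<Longrightarrow> shift_class n (G i)"
  shows "shift_class (n + 1) (graph_product V E G)"
proof -
  obtain \<phi> where \<phi>: "\<And>i. i \<in> V \<Longrightarrow> faithful_shift_action n (G i) (\<phi> i)"
    using shift_class_imp_action[OF assms(4)] by metis
  obtain N and dec :: "nat \<Rightarrow> 'v letter_type" where dec: "dec N = Inert"
    "\<forall>i\<in>V. \<exists>d<N. dec d = Inner i" "\<forall>i\<in>V. \<forall>c<n. \<exists>d<N. dec d = Final i c"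
    using ex_letter_code[OF assms(2), of n] by blast
  have "group (G i)" if "i \<in> V" for i using assms(4)[OF that] by (simp add: shift_class_def)
  then interpret graph_shift V E G n \<phi> N dec
    using assms(1,3) \<phi> dec
    by (intro graph_shift.intro vertex_groups.intro graph_shift_axioms.intro) blast+
  show ?thesis using faithful_shift_action.shift_class[OF graph_product_action] by simp
qed

end
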